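(* Let $M(n)$, $T^\ast(n)$, $P^\ast(n)$ be defined by $$\sum_{n\ge 0} M(n)q^n=\frac{f_2^5f_5^5}{f_1f_{10}},\quad \sum_{n\ge 0} T^\ast(n)q^n=\frac{f_1^5f_{10}^5}{f_2f_5},\quad \sum_{n\ge0}P^\ast(n)q^n=f_1^4f_5^4.$$ Define integer sequences $(A_k)_{k\ge0}$, $(B_k)_{k\ge0}$, $(C_k)_{k\ge0}$ by $A_0=A_1=1$, $B_0=0$, $B_1=1$, $C_0=1$, $C_1=-4$, and for $k\geq 2$, $$A_k=-4A_{k-1}-8A_{k-2}+5\cdot 2^{k-1},\quad B_k=-4B_{k-1}-8B_{k-2}+5\cdot 2^{k-1},\quad C_k=-4C_{k-1}-8C_{k-2}.$$ Then for all $k\geq 1$, \begin{align*} \sum_{n=-1}^\infty M(2^kn+2^{k+1}-1)q^n &= A_k\frac{f_1^4f_5^4}{q}-8A_{k-1}f_2^4f_{10}^4+5\cdot 2^kf_1f_2f_5^3f_{10}^3,\\ \sum_{n=-1}^\infty T^\ast(2^kn+2^{k+1}-2)q^n &= B_k\frac{f_1^4f_5^4}{q}-8B_{k-1}f_2^4f_{10}^4+5\cdot 2^kf_1f_2f_5^3f_{10}^3,\\ \sum_{n=-1}^\infty P^\ast(2^kn+2^{k+1}-1)q^n &= C_k\frac{f_1^4f_5^4}{q}-8C_{k-1}f_2^4f_{10}^4. \end{align*}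
   Context: For a positive integer $m$, $f_m:=\prod_{n=1}^\infty(1-q^{mn})$, regarded as a formal power series in $q$ (identities are of formal Laurent series in $q$). *)

theory Defs
  imports
    "HOL-Analysis.Analysis"
    "HOL-Computational_Algebra.Formal_Laurent_Series"
begin

text \<open>
  All series have rational coefficients, so that quotients of products of the series f_m can be
  written with the division of the library. The infinite product is the library's
  \<^const>\<open>prodinf\<close> with respect to the q-adic metric on \<^typ>\<open>rat fps\<close>; it is indexed from 0, hence
  the \<^const>\<open>Suc\<close>.
\<close>

definition euler_f :: "nat \<Rightarrow> rat fps" where
  "euler_f m = (\<Prod>n. 1 - fps_X ^ (m * Suc n))"

lemma euler_f_has_prod:
  assumes "m > 0"
  shows "(\<lambda>n. 1 - fps_X ^ (m * Suc n)) has_prod euler_f m"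
proof -
  let ?g = "\<lambda>n. 1 - fps_X ^ (m * Suc n) :: rat fps"
  define P where "P = (\<lambda>n. \<Prod>i\<le>n. ?g i)"
  have step: "fps_nth (P (Suc n)) j = fps_nth (P n) j" if "j \<le> n" for n j
  proof -
    have "j < m * Suc (Suc n)"
      using that assms by (cases m) auto
    moreover have "P (Suc n) = P n - P n * fps_X ^ (m * Suc (Suc n))"
      by (simp only: P_def prod.atMost_Suc right_diff_distrib mult_1_right)
    ultimately show ?thesis
      by (simp only: fps_sub_nth fps_X_power_mult_right_nth) simp
  qed
  have stable: "fps_nth (P n) j = fps_nth (P j) j" if "j \<le> n" for n j
    using that by (induction n rule: dec_induct) (auto simp: step)
  define p where "p = Abs_fps (\<lambda>j. fps_nth (P j) j)"
  have "P \<longlonglongrightarrow> p"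
  proof (rule tendsto_fpsI)
    fix j show "\<forall>\<^sub>F n in sequentially. fps_nth (P n) j = fps_nth p j"
      using eventually_ge_at_top[of j] by eventually_elim (simp add: p_def, rule stable)
  qed
  moreover have "fps_nth p 0 = 1"
    using assms by (simp add: p_def P_def)
  then have "p \<noteq> 0"
    by auto
  ultimately have "raw_has_prod ?g 0 p"
    by (simp add: raw_has_prod_def P_def)
  then have "?g has_prod p"
    by (simp add: has_prod_def)
  then show ?thesis
    unfolding euler_f_def using has_prod_unique by force
qed

definition M :: "nat \<Rightarrow> rat" where
  "M n = fps_nth (euler_f 2 ^ 5 * euler_f 5 ^ 5 / (euler_f 1 * euler_f 10)) n"

definition T_star :: "nat \<Rightarrow> rat" where
  "T_star n = fps_nth (euler_f 1 ^ 5 * euler_f 10 ^ 5 / (euler_f 2 * euler_f 5)) n"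

definition P_star :: "nat \<Rightarrow> rat" where
  "P_star n = fps_nth (euler_f 1 ^ 4 * euler_f 5 ^ 4) n"

fun A :: "nat \<Rightarrow> int" where
  "A 0 = 1"
| "A (Suc 0) = 1"
| "A (Suc (Suc k)) = - 4 * A (Suc k) - 8 * A k + 5 * 2 ^ Suc k"

fun B :: "nat \<Rightarrow> int" where
  "B 0 = 0"
| "B (Suc 0) = 1"
| "B (Suc (Suc k)) = - 4 * B (Suc k) - 8 * B k + 5 * 2 ^ Suc k"

fun C :: "nat \<Rightarrow> int" where
  "C 0 = 1"
| "C (Suc 0) = - 4"
| "C (Suc (Suc k)) = - 4 * C (Suc k) - 8 * C k"

text \<open>The formal Laurent series with coefficient \<open>a n\<close> of \<open>q ^ n\<close> for \<open>n \<ge> -1\<close>, and 0 below.\<close>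

definition series_from_m1 :: "(int \<Rightarrow> rat) \<Rightarrow> rat fls" where
  "series_from_m1 a = Abs_fls (\<lambda>n. if n \<ge> -1 then a n else 0)"

lemma fls_nth_series_from_m1:
  "fls_nth (series_from_m1 a) n = (if n \<ge> -1 then a n else 0)"
  unfolding series_from_m1_def
  by (subst nth_Abs_fls_lower_bound[where N = "-1"]) auto

abbreviation F :: "nat \<Rightarrow> rat fls" where
  "F m \<equiv> fps_to_fls (euler_f m)"

end

theory Submission
  imports Defs
begin

text \<open>
  Let \<open>q\<close> act as \<open>fps_X\<close>, \<open>P = f_1^4 f_5^4\<close>, \<open>P' = f_2^4 f_10^4\<close> (that is, \<open>P\<close> at \<open>q^2\<close>) and
  \<open>G = f_1 f_2 f_5^3 f_10^3\<close>. The generating functions are \<open>P + 5 q G\<close> for \<open>M\<close> and \<open>5 G - 4 P'\<close> for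
  \<open>T_star\<close>. Extraction of odd-indexed coefficients sends \<open>P\<close> to \<open>-4 P - 8 q P'\<close>, \<open>q P'\<close> to \<open>P\<close> and
  \<open>q G\<close> to \<open>P + 2 q G\<close>, so the span of these three series is preserved and the coefficients satisfy the
  recurrences of \<open>A\<close>, \<open>B\<close>, \<open>C\<close>.

  These facts rest on two relations between eta quotients of level 10 and on the odd part of
  \<open>\<phi>(q) \<phi>(-q^5)\<close>. By the Jacobi triple product each becomes an identity between sums over \<open>\<int>^2\<close> for the
  forms \<open>x^2 + y^2\<close> and \<open>x^2 + 5 y^2\<close>. It follows by splitting the lattice into classes
  modulo \<open>2 + i\<close>, the nonzero ones of which multiplication by \<open>i\<close> permutes, or by the residue of \<open>x + y\<close> modulo 6.
\<close>

section \<open>Limits of power series, Euler products and Gaussian binomials\<close>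

lemma tendsto_mult_fps:
  fixes f g :: "nat \<Rightarrow> 'a :: comm_ring_1 fps"
  assumes "f \<longlonglongrightarrow> f'" "g \<longlonglongrightarrow> g'"
  shows "(\<lambda>n. f n * g n) \<longlonglongrightarrow> f' * g'"
proof (rule tendsto_fpsI)
  fix k
  have "\<forall>\<^sub>F n in sequentially. \<forall>i\<in>{..k}. fps_nth (f n) i = fps_nth f' i"
    using assms(1) by (intro eventually_ball_finite) (auto simp: tendsto_fps_iff)
  moreover have "\<forall>\<^sub>F n in sequentially. \<forall>i\<in>{..k}. fps_nth (g n) i = fps_nth g' i"
    using assms(2) by (intro eventually_ball_finite) (auto simp: tendsto_fps_iff)
  ultimately show "\<forall>\<^sub>F n in sequentially. fps_nth (f n * g n) k = fps_nth (f' * g') k"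
    by eventually_elim (auto simp: fps_mult_nth intro!: sum.cong)
qed

lemma tendsto_power_fps:
  fixes f :: "nat \<Rightarrow> 'a :: comm_ring_1 fps"
  assumes "f \<longlonglongrightarrow> f'"
  shows "(\<lambda>n. f n ^ k) \<longlonglongrightarrow> f' ^ k"
  by (induction k) (auto intro: tendsto_mult_fps assms)

definition euler_fin :: "nat \<Rightarrow> nat \<Rightarrow> rat fps" where
  "euler_fin m N = (\<Prod>i<N. 1 - fps_X ^ (m * Suc i))"

text \<open>The partial product \<open>(-e q^a; q^d)_N\<close> of a q-Pochhammer symbol. The sign is
  that of the factors in the triple product; \<open>e = -1\<close> and \<open>a = d\<close> give
  back \<open>euler_fin\<close>.\<close>

definition qpoch :: "rat \<Rightarrow> nat \<Rightarrow> nat \<Rightarrow> nat \<Rightarrow> rat fps" where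
  "qpoch e a d N = (\<Prod>i<N. 1 + fps_const e * fps_X ^ (a + d * i))"

lemma euler_fin_LIMSEQ:
  assumes "m > 0"
  shows "euler_fin m \<longlonglongrightarrow> euler_f m"
  using has_prod_imp_tendsto'[OF euler_f_has_prod[OF assms]] unfolding euler_fin_def .

lemma euler_f_nth_0 [simp]:
  assumes "m > 0"
  shows "fps_nth (euler_f m) 0 = 1"
proof -
  have *: "fps_nth (euler_fin m N) 0 = 1" for N
    using assms by (induction N) (auto simp: euler_fin_def fps_mult_nth_0)
  have "\<forall>\<^sub>F N in sequentially. fps_nth (euler_fin m N) 0 = fps_nth (euler_f m) 0"
    using euler_fin_LIMSEQ[OF assms] by (simp add: tendsto_fps_iff)
  then show ?thesis by (simp add: *)
qed

lemma euler_f_nonzero [simp]: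
  assumes "m > 0"
  shows "euler_f m \<noteq> 0"
proof
  assume "euler_f m = 0"
  with euler_f_nth_0[OF assms] show False by simp
qed

text \<open>Substituting \<open>q^2\<close> commutes with the limit, because coefficient
  \<open>k\<close> after the substitution depends at most on coefficient \<open>k div 2\<close>
  before it.\<close>

lemma euler_f_compose:
  assumes "m > 0"
  shows "euler_f (2 * m) = euler_f m oo fps_X ^ 2"
proof (rule LIMSEQ_unique)
  show "euler_fin (2 * m) \<longlonglongrightarrow> euler_f (2 * m)"
    using assms by (intro euler_fin_LIMSEQ) auto
  have eq: "euler_fin (2 * m) = (\<lambda>N. euler_fin m N oo fps_X ^ 2)"
  proof
    fix N
    have X2: "fps_X ^ k oo fps_X ^ 2 = ((fps_X :: rat fps) ^ 2) ^ k" for k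
      by (rule fps_X_power_compose) simp
    have "(fps_X :: rat fps) ^ (2 * m * Suc i) = fps_X ^ (m * Suc i) oo fps_X ^ 2" for i
      by (simp only: X2 power_mult [symmetric] mult.assoc)
    then show "euler_fin (2 * m) N = euler_fin m N oo fps_X ^ 2"
      unfolding euler_fin_def
      by (simp add: fps_compose_prod_distrib fps_compose_sub_distrib del: mult_Suc_right)
  qed
  show "euler_fin (2 * m) \<longlonglongrightarrow> (euler_f m oo fps_X ^ 2)"
    unfolding eq
  proof (rule tendsto_fpsI)
    fix k
    have "\<forall>\<^sub>F N in sequentially. fps_nth (euler_fin m N) (k div 2) = fps_nth (euler_f m) (k div 2)"
      using euler_fin_LIMSEQ[OF assms] by (simp add: tendsto_fps_iff)
    then show "\<forall>\<^sub>F N in sequentially.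
        fps_nth (euler_fin m N oo fps_X ^ 2) k = fps_nth (euler_f m oo fps_X ^ 2) k"
      by eventually_elim (simp add: fps_nth_compose_X_power)
  qed
qed

text \<open>Gaussian binomial coefficients, given by the q-Pascal rule and not as quotients, so that
  they make sense in every commutative ring.\<close>

fun qbinomial :: "'a :: comm_ring_1 \<Rightarrow> nat \<Rightarrow> nat \<Rightarrow> 'a" where
  "qbinomial Q n 0 = 1"
| "qbinomial Q 0 (Suc k) = 0"
| "qbinomial Q (Suc n) (Suc k) = qbinomial Q n (Suc k) + Q ^ (n - k) * qbinomial Q n k"

lemma qbinomial_eq_0: "n < k \<Longrightarrow> qbinomial Q n k = 0"
  by (induction Q n k rule: qbinomial.induct) auto

lemma qbinomial_self [simp]: "qbinomial Q n n = 1"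
  by (induction n) (auto simp: qbinomial_eq_0)

text \<open>The two terms of the Pascal rule contribute \<open>1 - Q^(n-j)\<close> and
  \<open>Q^(n-j) (1 - Q^(j+1))\<close> times a common product; these add up to
  \<open>1 - Q^(n+1)\<close>.\<close>

lemma qbinomial_fact:
  fixes Q :: "'a :: comm_ring_1"
  assumes "k \<le> n"
  shows "qbinomial Q n k * (\<Prod>i<k. 1 - Q ^ Suc i) * (\<Prod>i<n-k. 1 - Q ^ Suc i) = (\<Prod>i<n. 1 - Q ^ Suc i)"
  using assms
proof (induction n arbitrary: k)
  case (Suc n)
  let ?P = "\<lambda>k. \<Prod>i<k. 1 - Q ^ Suc i"
  consider "k = 0" | "k = Suc n" | j where "k = Suc j" "j < n"
    using Suc.prems by (cases k) force+
  then show ?case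
  proof cases
    case 3
    have n: "n - j = Suc (n - Suc j)" using 3 by simp
    have I1: "qbinomial Q n j * ?P j * ?P (n - j) = ?P n"
      using 3 Suc.IH[of j] by simp
    have I2: "qbinomial Q n (Suc j) * ?P (Suc j) * ?P (n - Suc j) = ?P n"
      using 3 Suc.IH[of "Suc j"] by simp
    have q: "Q ^ Suc n = Q ^ (n - j) * Q ^ Suc j"
      unfolding power_add [symmetric] using 3 by (intro arg_cong[where f = "power Q"]) auto
    have p: "?P (n - j) = ?P (n - Suc j) * (1 - Q ^ (n - j))"
      unfolding n prod.lessThan_Suc ..
    have p': "?P (Suc j) = ?P j * (1 - Q ^ Suc j)"
      by (rule prod.lessThan_Suc)
    have "qbinomial Q (Suc n) k * ?P k * ?P (Suc n - k)
        = (qbinomial Q n (Suc j) + Q ^ (n - j) * qbinomial Q n j) * ?P (Suc j) * ?P (n - j)"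
      using 3 by simp
    also have "\<dots> = qbinomial Q n (Suc j) * ?P (Suc j) * ?P (n - j)
        + Q ^ (n - j) * (qbinomial Q n j * ?P (Suc j) * ?P (n - j))"
      by (simp add: algebra_simps)
    also have "\<dots> = (qbinomial Q n (Suc j) * ?P (Suc j) * ?P (n - Suc j)) * (1 - Q ^ (n - j))
        + Q ^ (n - j) * (qbinomial Q n j * ?P j * ?P (n - j)) * (1 - Q ^ Suc j)"
      unfolding p' by (subst p) (simp add: mult_ac)
    also have "\<dots> = ?P n * (1 - Q ^ Suc n)"
      unfolding I1 I2 q by (simp add: algebra_simps)
    also have "\<dots> = ?P (Suc n)" by (simp add: mult_ac)
    finally show ?thesis .
  qed auto
qed auto

text \<open>The homogeneous form of the q-binomial theorem: in the triple product a high power of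
  \<open>q\<close> for \<open>y\<close> replaces the usual negative powers.\<close>

lemma qbinomial_theorem:
  fixes Q x y :: "'a :: comm_ring_1"
  shows "(\<Prod>i<n. y + x * Q ^ i) = (\<Sum>k\<le>n. Q ^ (k * (k - 1) div 2) * qbinomial Q n k * x ^ k * y ^ (n - k))"
proof (induction n)
  case (Suc n)
  define t where "t n k = Q ^ (k * (k - 1) div 2) * qbinomial Q n k * x ^ k * y ^ (n - k)" for n k
  have tri: "Suc k * (Suc k - 1) div 2 = k * (k - 1) div 2 + k" for k :: nat
    by (cases k) (auto simp: algebra_simps)
  \<comment> \<open>The Pascal rule, term by term. The case \<open>k = n\<close> is separate because
    the truncated exponent \<open>n - Suc k\<close> then does not lie one below
    \<open>n - k\<close>.\<close>
  have a: "t (Suc n) (Suc k) = t n (Suc k) * y + t n k * (x * Q ^ n)" if "k \<le> n" for k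
  proof (cases "k = n")
    case True
    then show ?thesis
      unfolding t_def tri by (simp add: qbinomial_eq_0 power_add mult_ac)
  next
    case False
    with that have "n - k = Suc (n - Suc k)" by simp
    then have y: "y ^ (n - k) = y * y ^ (n - Suc k)"
      by (simp only: power_Suc)
    have q: "Q ^ n = Q ^ k * Q ^ (n - k)"
      unfolding power_add [symmetric] using that by (intro arg_cong[where f = "power Q"]) auto
    show ?thesis
      unfolding t_def tri y q
      by (simp only: qbinomial.simps diff_Suc_Suc y power_add power_Suc ring_distribs mult_ac)
  qed
  have "(\<Prod>i<Suc n. y + x * Q ^ i) = (\<Sum>k\<le>n. t n k) * (y + x * Q ^ n)"
    using Suc.IH by (simp add: t_def)
  also have "\<dots> = (\<Sum>k\<le>n. t n k * y) + (\<Sum>k\<le>n. t n k * (x * Q ^ n))"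
    by (simp add: distrib_left sum_distrib_right)
  also have "(\<Sum>k\<le>n. t n k * y) = (\<Sum>k\<le>Suc n. t n k * y)"
    by (simp add: t_def qbinomial_eq_0)
  also have "\<dots> = t n 0 * y + (\<Sum>k\<le>n. t n (Suc k) * y)"
    by (rule sum.atMost_Suc_shift)
  also have "t n 0 * y = t (Suc n) 0"
    by (simp add: t_def)
  also have "t (Suc n) 0 + (\<Sum>k\<le>n. t n (Suc k) * y) + (\<Sum>k\<le>n. t n k * (x * Q ^ n))
      = t (Suc n) 0 + (\<Sum>k\<le>n. t (Suc n) (Suc k))"
    by (simp add: a sum.distrib add.assoc)
  also have "\<dots> = (\<Sum>k\<le>Suc n. t (Suc n) k)"
    by (rule sum.atMost_Suc_shift [symmetric])
  finally show ?case by (simp add: t_def)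
qed auto

section \<open>Theta series and the Jacobi triple product\<close>

text \<open>The series of all \<open>w i * q^(e i)\<close>. It has this meaning when the fibres of
  \<open>e\<close> in \<open>I\<close> are finite, since \<open>sum\<close> over an infinite set is
  0.\<close>

definition wsum :: "'i set \<Rightarrow> ('i \<Rightarrow> rat) \<Rightarrow> ('i \<Rightarrow> nat) \<Rightarrow> rat fps" where
  "wsum I w e = Abs_fps (\<lambda>k. \<Sum>i | i \<in> I \<and> e i = k. w i)"

definition theta_exp :: "nat \<Rightarrow> nat \<Rightarrow> int \<Rightarrow> nat" where
  "theta_exp a b j = a * nat (j * (j + 1) div 2) + b * nat (j * (j - 1) div 2)"

text \<open>For \<open>s = 1\<close> or \<open>s = -1\<close> this is Ramanujan's
  \<open>f(s q^a, s q^b)\<close>, because \<open>s^(j^2) = s^|j|\<close>. Thus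
  \<open>theta s 1 1\<close> is \<open>phi(s q)\<close> and \<open>theta 1 0 1\<close> is
  \<open>2 psi(q)\<close>.\<close>

definition theta :: "rat \<Rightarrow> nat \<Rightarrow> nat \<Rightarrow> rat fps" where
  "theta s a b = wsum UNIV (\<lambda>j. s ^ nat \<bar>j\<bar>) (theta_exp a b)"

lemma nat_eqI_double: "2 * int m = 2 * int n \<Longrightarrow> m = n"
  by simp

text \<open>Doubled and over the integers, the exponent is a polynomial in \<open>j\<close>, so
  comparing exponents under a linear substitution becomes a ring identity.\<close>

lemma theta_exp_int: "2 * int (theta_exp a b j) = (int a + int b) * j\<^sup>2 + (int a - int b) * j"
proof -
  have "0 \<le> j * (j + 1)" "0 \<le> j * (j - 1)"
    by (auto simp: zero_le_mult_iff)
  then have "int (theta_exp a b j) = int a * (j * (j + 1) div 2) + int b * (j * (j - 1) div 2)"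
    by (simp add: theta_exp_def)
  moreover have "2 * (int a * u + int b * v) = int a * (2 * u) + int b * (2 * v)" for u v :: int
    by (simp add: algebra_simps)
  moreover have "2 * (j * (j + 1) div 2) = j * (j + 1)" "2 * (j * (j - 1) div 2) = j * (j - 1)"
    by (auto simp: dvd_mult_div_cancel)
  ultimately have "2 * int (theta_exp a b j) = int a * (j * (j + 1)) + int b * (j * (j - 1))"
    by (simp only:)
  then show ?thesis by (simp add: algebra_simps power2_eq_square)
qed

text \<open>A linear bound is enough to make the fibres finite and to restrict each coefficient in
  the triple product to finitely many indices.\<close>

lemma theta_exp_ge:
  assumes "a + b > 0"
  shows "\<bar>j\<bar> \<le> int (theta_exp a b j) + 1"
proof -
  have 1: "\<bar>j\<bar> \<le> j * (j + 1) div 2 + 1" "\<bar>j\<bar> \<le> j * (j - 1) div 2 + 1" 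
  proof -
    have "2 * \<bar>j\<bar> - 2 \<le> \<bar>j\<bar> * (\<bar>j\<bar> - 1)"
    proof (cases "\<bar>j\<bar> \<le> 1")
      case True
      then have "j = 0 \<or> j = 1 \<or> j = -1" by auto
      then show ?thesis by auto
    next
      case False
      have "0 \<le> (\<bar>j\<bar> - 1) * (\<bar>j\<bar> - 2)" using False by (intro mult_nonneg_nonneg) auto
      then show ?thesis by (simp add: algebra_simps)
    qed
    moreover have "\<bar>j\<bar> * (\<bar>j\<bar> - 1) \<le> j * (j + 1)" "\<bar>j\<bar> * (\<bar>j\<bar> - 1) \<le> j * (j - 1)"
      by (auto simp: abs_if algebra_simps)
    ultimately show "\<bar>j\<bar> \<le> j * (j + 1) div 2 + 1" "\<bar>j\<bar> \<le> j * (j - 1) div 2 + 1" 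
      by linarith+
  qed
  show ?thesis
  proof (cases "a > 0")
    case True
    have "nat (j * (j + 1) div 2) \<le> a * nat (j * (j + 1) div 2)" using True by simp
    then have "nat (j * (j + 1) div 2) \<le> theta_exp a b j" unfolding theta_exp_def by linarith
    with 1 show ?thesis by linarith
  next
    case False
    then have "b > 0" using assms by simp
    then have "nat (j * (j - 1) div 2) \<le> b * nat (j * (j - 1) div 2)" by simp
    then have "nat (j * (j - 1) div 2) \<le> theta_exp a b j" unfolding theta_exp_def by linarith
    with 1 show ?thesis by linarith
  qed
qed

lemma finite_theta_exp:
  assumes "a + b > 0"
  shows "finite {j. theta_exp a b j = k}"
proof (rule finite_subset)
  show "{j. theta_exp a b j = k} \<subseteq> {-int k - 1..int k + 1}"
  proof
    fix j assume "j \<in> {j. theta_exp a b j = k}"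
    with theta_exp_ge[OF assms, of j] show "j \<in> {-int k - 1..int k + 1}" by auto
  qed
qed auto

text \<open>The finite Jacobi triple product: the q-binomial theorem for \<open>2 N\<close> factors
  \<open>y + x Q^i\<close> with \<open>x = s q^a\<close>, \<open>y = q^(d N)\<close>,
  \<open>Q = q^d\<close>. The upper half of the factors gives \<open>qpoch s a\<close>, the lower
  half read backwards gives \<open>qpoch s b\<close>, and the powers of \<open>q\<close> and
  \<open>s\<close> taken out cancel.\<close>

lemma theta_finite_form:
  fixes s :: rat
  assumes s: "s * s = 1"
  shows "qpoch s a (a + b) N * qpoch s b (a + b) N =
    (\<Sum>k\<le>2*N. fps_const (s ^ nat \<bar>int k - int N\<bar>) * fps_X ^ theta_exp a b (int k - int N)
        * qbinomial (fps_X ^ (a + b)) (2 * N) k)"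
    (is "?P = ?R")
proof -
  define d where "d = a + b"
  define Q x y where "Q = (fps_X :: rat fps) ^ d" and "x = fps_const s * fps_X ^ a"
    and "y = (fps_X :: rat fps) ^ (d * N)"
  \<comment> \<open>\<open>c\<close> is the exponent of \<open>q\<close> taken out of the lower
    \<open>N\<close> factors, \<open>m\<close> the one taken out of all \<open>2 N\<close>.\<close>
  define c where "c = (\<Sum>i<N. a + d * i)"
  define m where "m = d * N * N + c"
  have c2: "2 * int c = 2 * int a * int N + int d * int N * (int N - 1)"
    unfolding c_def by (induction N) (auto simp: algebra_simps)
  \<comment> \<open>The exponents \<open>k + N\<close> and \<open>|k - N|\<close> have the same
    parity.\<close>
  have ss: "s ^ (k + N) = s ^ nat \<bar>int k - int N\<bar>" for k
  proof (cases "k \<le> N")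
    case True
    then have "k + N = nat \<bar>int k - int N\<bar> + 2 * k" by auto
    then have "s ^ (k + N) = s ^ nat \<bar>int k - int N\<bar> * (s * s) ^ k"
      by (simp only: power_add power_mult power2_eq_square)
    then show ?thesis using s by simp
  next
    case False
    then have "k + N = nat \<bar>int k - int N\<bar> + 2 * N" by auto
    then have "s ^ (k + N) = s ^ nat \<bar>int k - int N\<bar> * (s * s) ^ N"
      by (simp only: power_add power_mult power2_eq_square)
    then show ?thesis using s by simp
  qed
  have "(\<Prod>i<N. y + x * Q ^ (N + i)) = (\<Prod>i<N. y * (1 + fps_const s * fps_X ^ (a + d * i)))"
  proof (intro prod.cong refl)
    fix i
    have "x * Q ^ (N + i) = y * (fps_const s * fps_X ^ (a + d * i))"
      unfolding x_def y_def Q_def power_mult [symmetric] by (simp only: distrib_left power_add mult_ac)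
    then show "y + x * Q ^ (N + i) = y * (1 + fps_const s * fps_X ^ (a + d * i))"
      by (simp only: distrib_left mult_1_right)
  qed
  also have "\<dots> = fps_X ^ (d * N * N) * qpoch s a d N"
    by (simp add: prod.distrib qpoch_def y_def power_mult)
  finally have p1: "(\<Prod>i<N. y + x * Q ^ (N + i)) = fps_X ^ (d * N * N) * qpoch s a d N" .
  have "(\<Prod>i<N. y + x * Q ^ i) = (\<Prod>i<N. y + x * Q ^ (N - Suc i))"
    by (rule prod.nat_diff_reindex [symmetric])
  also have "\<dots> = (\<Prod>i<N. fps_const s * fps_X ^ (a + d * (N - Suc i)) * (1 + fps_const s * fps_X ^ (b + d * i)))"
  proof (intro prod.cong refl)
    fix i assume "i \<in> {..<N}"
    then have N: "N = Suc i + (N - Suc i)" by simp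
    \<comment> \<open>Here \<open>d = a + b\<close> enters: once the second term of the factor is
      taken out, what remains of \<open>y\<close> has exponent \<open>b + d i\<close>, with sign
      \<open>1/s = s\<close>.\<close>
    have "d * N = a + d * (N - Suc i) + (b + d * i)"
      by (subst N) (simp add: d_def algebra_simps)
    then have y: "y = fps_X ^ (a + d * (N - Suc i)) * fps_X ^ (b + d * i)"
      unfolding y_def power_add [symmetric] by simp
    have cs: "fps_const s * fps_const s = 1" using s by simp
    have cs1: "fps_const s * (fps_const s * z) = z" for z
      using cs by (simp flip: mult.assoc)
    have "x * Q ^ (N - Suc i) = fps_const s * fps_X ^ (a + d * (N - Suc i))"
      unfolding x_def Q_def power_mult [symmetric] by (simp only: power_add mult_ac)
    then show "y + x * Q ^ (N - Suc i) = fps_const s * fps_X ^ (a + d * (N - Suc i)) * (1 + fps_const s * fps_X ^ (b + d * i))"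
      unfolding y by (simp only: distrib_left mult_1_right mult.assoc mult.left_commute[of "fps_X ^ (a + d * (N - Suc i))" "fps_const s"] cs1 add.commute)
  qed
  also have "\<dots> = fps_const s ^ N * (\<Prod>i<N. fps_X ^ (a + d * (N - Suc i))) * qpoch s b d N"
    by (simp add: prod.distrib qpoch_def)
  also have "(\<Prod>i<N. (fps_X :: rat fps) ^ (a + d * (N - Suc i))) = (\<Prod>i<N. fps_X ^ (a + d * i))"
    by (rule prod.nat_diff_reindex)
  also have "\<dots> = fps_X ^ c"
    by (simp add: c_def power_sum)
  finally have p2: "(\<Prod>i<N. y + x * Q ^ i) = fps_const s ^ N * fps_X ^ c * qpoch s b d N" .
  have "(\<Prod>i<2*N. y + x * Q ^ i) = (\<Prod>i<N. y + x * Q ^ i) * (\<Prod>i<N. y + x * Q ^ (N + i))"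
  proof -
    have "(\<Prod>i<N+n. y + x * Q ^ i) = (\<Prod>i<N. y + x * Q ^ i) * (\<Prod>i<n. y + x * Q ^ (N + i))" for n
      by (induction n) (auto simp: mult_ac)
    from this[of N] show ?thesis by (simp add: mult_2)
  qed
  also have "\<dots> = fps_X ^ m * (fps_const s ^ N * (qpoch s a d N * qpoch s b d N))"
    by (simp only: p1 p2 m_def) (simp only: power_add mult_ac)
  finally have L: "(\<Prod>i<2*N. y + x * Q ^ i) = fps_X ^ m * (fps_const s ^ N * ?P)"
    by (simp add: d_def)
  have "(\<Prod>i<2*N. y + x * Q ^ i) = (\<Sum>k\<le>2*N. Q ^ (k * (k - 1) div 2) * qbinomial Q (2 * N) k * x ^ k * y ^ (2 * N - k))"
    by (rule qbinomial_theorem)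
  also have "\<dots> = (\<Sum>k\<le>2*N. fps_X ^ m * (fps_const s ^ N * (fps_const (s ^ nat \<bar>int k - int N\<bar>) * fps_X ^ theta_exp a b (int k - int N)
        * qbinomial (fps_X ^ (a + b)) (2 * N) k)))"
  proof (intro sum.cong refl)
    fix k assume "k \<in> {..2*N}"
    then have k: "k \<le> 2 * N" by simp
    have tri: "2 * int (k * (k - 1) div 2) = int k * (int k - 1)"
      by (cases k) (auto simp: of_nat_div dvd_mult_div_cancel, auto simp: algebra_simps)
    have "2 * int (d * (k * (k - 1) div 2) + a * k + d * N * (2 * N - k))
        = int d * (2 * int (k * (k - 1) div 2)) + 2 * int a * int k + 2 * int d * int N * (2 * int N - int k)"
      using k by (simp only: of_nat_add of_nat_mult of_nat_diff) (simp add: algebra_simps)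
    also have "\<dots> = 2 * (int d * int N * int N) + 2 * int c + 2 * int (theta_exp a b (int k - int N))"
      unfolding tri c2 theta_exp_int by (simp add: d_def algebra_simps power2_eq_square)
    also have "\<dots> = 2 * int (m + theta_exp a b (int k - int N))"
      by (simp add: m_def)
    finally have "2 * int (d * (k * (k - 1) div 2) + a * k + d * N * (2 * N - k)) = 2 * int (m + theta_exp a b (int k - int N))" .
    then have e: "d * (k * (k - 1) div 2) + a * k + d * N * (2 * N - k) = m + theta_exp a b (int k - int N)"
      by (rule nat_eqI_double)
    have "fps_const s ^ N * fps_const (s ^ nat \<bar>int k - int N\<bar>) = fps_const (s ^ k * (s * s) ^ N)"
      unfolding ss [symmetric] by (simp add: fps_const_power power_add power_mult_distrib mult_ac)
    then have sg: "fps_const s ^ N * fps_const (s ^ nat \<bar>int k - int N\<bar>) = fps_const s ^ k"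
      using s by (simp add: fps_const_power)
    have "Q ^ (k * (k - 1) div 2) * qbinomial Q (2 * N) k * x ^ k * y ^ (2 * N - k)
       = fps_const s ^ k * (fps_X ^ (d * (k * (k - 1) div 2)) * fps_X ^ (a * k) * fps_X ^ (d * N * (2 * N - k))) * qbinomial Q (2 * N) k"
      by (simp only: Q_def x_def y_def power_mult_distrib power_mult mult_ac)
    also have "\<dots> = fps_const s ^ k * (fps_X ^ m * fps_X ^ theta_exp a b (int k - int N)) * qbinomial Q (2 * N) k"
      unfolding power_add [symmetric] e ..
    also have "\<dots> = fps_X ^ m * (fps_const s ^ N * (fps_const (s ^ nat \<bar>int k - int N\<bar>) * fps_X ^ theta_exp a b (int k - int N)
        * qbinomial (fps_X ^ (a + b)) (2 * N) k))"
      unfolding sg [symmetric] Q_def d_def by (simp only: mult_ac)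
    finally show "Q ^ (k * (k - 1) div 2) * qbinomial Q (2 * N) k * x ^ k * y ^ (2 * N - k) = \<dots>" .
  qed
  also have "\<dots> = fps_X ^ m * (fps_const s ^ N * ?R)"
    by (simp only: sum_distrib_left)
  finally have "fps_X ^ m * (fps_const s ^ N * ?P) = fps_X ^ m * (fps_const s ^ N * ?R)"
    unfolding L .
  moreover have "s \<noteq> 0" using s by auto
  ultimately show ?thesis by simp
qed

text \<open>With \<open>Q = q^d\<close> the binomial is
  \<open>(Q)_(2N) / ((Q)_(N+j) (Q)_(N-j))\<close>. Every factor tends to \<open>euler_f d\<close>,
  and the additional \<open>euler_fin d N\<close> balances numerator and denominator.\<close>

lemma qbinomial_LIMSEQ:
  assumes "d > 0"
  shows "(\<lambda>N. qbinomial (fps_X ^ d) (2 * N) (nat (int N + j)) * euler_fin d N) \<longlonglongrightarrow> 1"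
proof -
  let ?f = "euler_f d"
  have fact: "(\<Prod>i<n. 1 - (fps_X ^ d :: rat fps) ^ Suc i) = euler_fin d n" for n
    by (simp only: euler_fin_def power_mult)
  have nz: "fps_nth (euler_fin d n) 0 \<noteq> 0" for n
    using assms by (induction n) (auto simp: euler_fin_def fps_mult_nth_0)
  have 1: "(\<lambda>N. euler_fin d (nat (int N + j))) \<longlonglongrightarrow> ?f" for j
  proof (rule filterlim_compose[OF euler_fin_LIMSEQ[OF assms]])
    show "filterlim (\<lambda>N. nat (int N + j)) at_top sequentially"
      unfolding filterlim_at_top
    proof
      fix Z
      show "\<forall>\<^sub>F N in sequentially. Z \<le> nat (int N + j)"
        using eventually_ge_at_top[of "Z + nat \<bar>j\<bar>"] by eventually_elim linarith
    qed
  qed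
  have 2: "(\<lambda>N. euler_fin d (2 * N)) \<longlonglongrightarrow> ?f"
    using LIMSEQ_subseq_LIMSEQ[OF euler_fin_LIMSEQ[OF assms], of "\<lambda>N. 2 * N"]
    by (simp add: strict_mono_def o_def)
  have "(\<lambda>N. (euler_fin d (2 * N) * euler_fin d N) * inverse (euler_fin d (nat (int N + j)) * euler_fin d (nat (int N + - j))))
     \<longlonglongrightarrow> (?f * ?f) * inverse (?f * ?f)"
    using assms by (intro tendsto_mult_fps tendsto_inverse_fps 1 2 euler_fin_LIMSEQ) auto
  also have "(?f * ?f) * inverse (?f * ?f) = 1"
    using assms by (intro inverse_mult_eq_1') auto
  finally have "(\<lambda>N. (euler_fin d (2 * N) * euler_fin d N) * inverse (euler_fin d (nat (int N + j)) * euler_fin d (nat (int N + - j))))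
     \<longlonglongrightarrow> 1" .
  \<comment> \<open>For \<open>N >= |j|\<close> neither \<open>nat\<close> truncates, so the product
    formula applies.\<close>
  moreover have "\<forall>\<^sub>F N in sequentially. (euler_fin d (2 * N) * euler_fin d N) * inverse (euler_fin d (nat (int N + j)) * euler_fin d (nat (int N + - j)))
      = qbinomial (fps_X ^ d) (2 * N) (nat (int N + j)) * euler_fin d N"
    using eventually_ge_at_top[of "nat \<bar>j\<bar>"]
  proof eventually_elim
    case (elim N)
    let ?D = "euler_fin d (nat (int N + j)) * euler_fin d (nat (int N + - j))"
    have "nat (int N + j) \<le> 2 * N" "2 * N - nat (int N + j) = nat (int N + - j)"
      using elim by auto
    then have E: "euler_fin d (2 * N) = qbinomial (fps_X ^ d) (2 * N) (nat (int N + j)) * ?D"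
      using qbinomial_fact[of "nat (int N + j)" "2 * N" "fps_X ^ d :: rat fps"]
      unfolding fact by (simp add: mult.assoc)
    have D: "?D * inverse ?D = 1"
      using nz by (intro inverse_mult_eq_1') (simp add: fps_mult_nth_0)
    from E have "(euler_fin d (2 * N) * euler_fin d N) * inverse ?D
        = qbinomial (fps_X ^ d) (2 * N) (nat (int N + j)) * euler_fin d N * (?D * inverse ?D)"
      by (simp only: mult_ac)
    then show ?case unfolding D by simp
  qed
  ultimately show ?thesis
    by (rule Lim_transform_eventually)
qed

text \<open>The termwise limit of the finite form. By \<open>theta_exp_ge\<close>, coefficient
  \<open>n\<close> only sees indices in the fixed finite set \<open>J\<close>, so finitely many
  instances of \<open>qbinomial_LIMSEQ\<close> suffice.\<close>

lemma jacobi_triple_product: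
  fixes s :: rat
  assumes s: "s * s = 1" and ab: "a + b > 0"
  shows "(\<lambda>N. qpoch s a (a + b) N * qpoch s b (a + b) N * euler_fin (a + b) N) \<longlonglongrightarrow> theta s a b"
proof (rule tendsto_fpsI)
  fix n
  define J where "J = {-(int n + 1)..int n + 1}"
  define g where "g N j = qbinomial (fps_X ^ (a + b)) (2 * N) (nat (int N + j)) * euler_fin (a + b) N" for N j
  define t where "t N j = fps_const (s ^ nat \<bar>j\<bar>) * fps_X ^ theta_exp a b j * g N j" for N j
  have P: "qpoch s a (a + b) N * qpoch s b (a + b) N * euler_fin (a + b) N = (\<Sum>j=-int N..int N. t N j)" for N
    unfolding theta_finite_form[OF s] sum_distrib_right t_def g_def
    by (rule sum.reindex_bij_witness[of _ "\<lambda>j. nat (int N + j)" "\<lambda>k. int k - int N"])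
       (auto simp: mult.assoc)
  have tn: "fps_nth (t N j) n = (if theta_exp a b j \<le> n then s ^ nat \<bar>j\<bar> * fps_nth (g N j) (n - theta_exp a b j) else 0)" for N j
    by (auto simp: t_def mult.assoc fps_X_power_mult_nth)
  have "\<forall>\<^sub>F N in sequentially. \<forall>j\<in>J. \<forall>i\<in>{..n}. fps_nth (g N j) i = fps_nth 1 i"
    using qbinomial_LIMSEQ[OF ab] unfolding g_def J_def tendsto_fps_iff
    by (intro eventually_ball_finite ballI) auto
  then show "\<forall>\<^sub>F N in sequentially. fps_nth (qpoch s a (a + b) N * qpoch s b (a + b) N * euler_fin (a + b) N) n
      = fps_nth (theta s a b) n"
    using eventually_ge_at_top[of "n + 1"]
  proof eventually_elim
    case (elim N)
    have "fps_nth (\<Sum>j=-int N..int N. t N j) n = (\<Sum>j=-int N..int N. fps_nth (t N j) n)"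
      by (simp add: fps_sum_nth)
    also have "\<dots> = (\<Sum>j\<in>J. fps_nth (t N j) n)"
    proof (rule sum.mono_neutral_right)
      show "\<forall>j\<in>{-int N..int N} - J. fps_nth (t N j) n = 0"
      proof
        fix j assume "j \<in> {-int N..int N} - J"
        with theta_exp_ge[OF ab, of j] have "\<not> theta_exp a b j \<le> n" by (auto simp: J_def)
        then show "fps_nth (t N j) n = 0" by (simp add: tn)
      qed
    qed (use elim in \<open>auto simp: J_def\<close>)
    also have "\<dots> = (\<Sum>j\<in>J. if theta_exp a b j = n then s ^ nat \<bar>j\<bar> else 0)"
    proof (intro sum.cong refl)
      fix j assume "j \<in> J"
      with elim(1) have "fps_nth (g N j) (n - theta_exp a b j) = fps_nth 1 (n - theta_exp a b j)" by auto
      then show "fps_nth (t N j) n = (if theta_exp a b j = n then s ^ nat \<bar>j\<bar> else 0)"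
        by (auto simp: tn)
    qed
    also have "\<dots> = (\<Sum>j | theta_exp a b j = n. s ^ nat \<bar>j\<bar>)"
    proof -
      have "{j \<in> J. theta_exp a b j = n} = {j. theta_exp a b j = n}"
      proof (intro equalityI subsetI)
        fix j assume "j \<in> {j. theta_exp a b j = n}"
        with theta_exp_ge[OF ab, of j] show "j \<in> {j \<in> J. theta_exp a b j = n}" by (auto simp: J_def)
      qed auto
      then show ?thesis by (simp add: sum.inter_filter [symmetric] J_def)
    qed
    finally show ?case unfolding P by (simp add: theta_def wsum_def)
  qed
qed

section \<open>Calculus of weighted lattice sums\<close>

lemma wsum_nth: "fps_nth (wsum I w e) k = (\<Sum>i | i \<in> I \<and> e i = k. w i)"
  by (simp add: wsum_def)

lemma wsum_cong_weight:
  assumes "\<And>i. i \<in> I \<Longrightarrow> w i = v i"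
  shows "wsum I w e = wsum I v e"
  by (rule fps_ext) (auto simp: wsum_nth assms intro!: sum.cong)

text \<open>Used both for symmetries of a lattice sum and for sublattices; in the latter case
  \<open>h\<close> parametrizes a class of points and \<open>g\<close> recovers the
  parameters.\<close>

lemma wsum_reindex:
  assumes "\<And>j. j \<in> J \<Longrightarrow> h j \<in> I" "\<And>i. i \<in> I \<Longrightarrow> g i \<in> J"
    and "\<And>i. i \<in> I \<Longrightarrow> h (g i) = i" "\<And>j. j \<in> J \<Longrightarrow> g (h j) = j"
    and "\<And>j. j \<in> J \<Longrightarrow> w (h j) = v j" "\<And>j. j \<in> J \<Longrightarrow> e (h j) = f j"
  shows "wsum I w e = wsum J v f"
proof (rule fps_ext)
  fix k
  show "fps_nth (wsum I w e) k = fps_nth (wsum J v f) k"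
    unfolding wsum_nth
    by (rule sum.reindex_bij_witness[of _ h g]) (use assms in \<open>force+\<close>)
qed

lemma wsum_uminus: "wsum I (\<lambda>i. - w i) e = - wsum I w e"
  by (rule fps_ext) (simp add: wsum_nth sum_negf)

lemma wsum_X_power_mult: "fps_X ^ c * wsum I w e = wsum I w (\<lambda>i. c + e i)"
proof (rule fps_ext)
  fix k
  show "fps_nth (fps_X ^ c * wsum I w e) k = fps_nth (wsum I w (\<lambda>i. c + e i)) k"
  proof (cases "k < c")
    case True
    then have "{i. i \<in> I \<and> c + e i = k} = {}" by auto
    then show ?thesis using True by (simp add: fps_X_power_mult_nth wsum_nth)
  next
    case False
    then have "{i. i \<in> I \<and> c + e i = k} = {i. i \<in> I \<and> e i = k - c}" by auto
    then show ?thesis using False by (simp add: fps_X_power_mult_nth wsum_nth)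
  qed
qed

lemma wsum_X_mult: "fps_X * wsum I w e = wsum I w (\<lambda>i. 1 + e i)"
  using wsum_X_power_mult[of 1] by simp

lemma finite_fibres_times:
  fixes e :: "'i \<Rightarrow> nat" and f :: "'j \<Rightarrow> nat"
  assumes "\<And>k. finite {i. i \<in> I \<and> e i = k}" "\<And>k. finite {j. j \<in> J \<and> f j = k}"
  shows "finite {p. p \<in> I \<times> J \<and> e (fst p) + f (snd p) = k}"
proof (rule finite_subset)
  show "{p. p \<in> I \<times> J \<and> e (fst p) + f (snd p) = k}
      \<subseteq> (\<Union>i\<le>k. {a. a \<in> I \<and> e a = i}) \<times> (\<Union>i\<le>k. {b. b \<in> J \<and> f b = i})"
    by auto
qed (use assms in auto)

text \<open>Grouping the pairs of total exponent \<open>k\<close> by the exponent of the first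
  component gives the Cauchy product.\<close>

lemma wsum_mult:
  fixes e :: "'i \<Rightarrow> nat" and f :: "'j \<Rightarrow> nat"
  assumes "\<And>k. finite {i. i \<in> I \<and> e i = k}" "\<And>k. finite {j. j \<in> J \<and> f j = k}"
  shows "wsum I w e * wsum J v f
    = wsum (I \<times> J) (\<lambda>p. w (fst p) * v (snd p)) (\<lambda>p. e (fst p) + f (snd p))"
proof (rule fps_ext)
  fix k
  let ?A = "\<lambda>i. {a. a \<in> I \<and> e a = i}" and ?B = "\<lambda>i. {b. b \<in> J \<and> f b = i}"
  let ?S = "{p. p \<in> I \<times> J \<and> e (fst p) + f (snd p) = k}"
  have fin: "finite ?S"
    using assms by (rule finite_fibres_times)
  have "fps_nth (wsum I w e * wsum J v f) k = (\<Sum>i\<in>{0..k}. (\<Sum>a\<in>?A i. \<Sum>b\<in>?B (k - i). w a * v b))"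
    by (simp add: fps_mult_nth wsum_nth sum_product)
  also have "\<dots> = (\<Sum>i\<in>{0..k}. \<Sum>p | p \<in> ?S \<and> e (fst p) = i. w (fst p) * v (snd p))"
  proof (intro sum.cong refl)
    fix i assume "i \<in> {0..k}"
    then have "{p. p \<in> ?S \<and> e (fst p) = i} = ?A i \<times> ?B (k - i)" by auto
    then show "(\<Sum>a\<in>?A i. \<Sum>b\<in>?B (k - i). w a * v b) = (\<Sum>p | p \<in> ?S \<and> e (fst p) = i. w (fst p) * v (snd p))"
      by (simp add: sum.cartesian_product case_prod_beta)
  qed
  also have "\<dots> = (\<Sum>p\<in>?S. w (fst p) * v (snd p))"
    by (rule sum.group) (use fin in auto)
  finally show "fps_nth (wsum I w e * wsum J v f) k
      = fps_nth (wsum (I \<times> J) (\<lambda>p. w (fst p) * v (snd p)) (\<lambda>p. e (fst p) + f (snd p))) k"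
    by (simp add: wsum_nth)
qed

lemma wsum_partition:
  assumes "\<And>k. finite {i. i \<in> I \<and> e i = k}" "finite R" "\<And>i. i \<in> I \<Longrightarrow> c i \<in> R"
  shows "wsum I w e = (\<Sum>r\<in>R. wsum {i \<in> I. c i = r} w e)"
proof (rule fps_ext)
  fix k
  have "(\<Sum>r\<in>R. \<Sum>i | i \<in> {i. i \<in> I \<and> e i = k} \<and> c i = r. w i) = (\<Sum>i | i \<in> I \<and> e i = k. w i)"
    by (rule sum.group) (use assms in auto)
  moreover have "{i. i \<in> {i. i \<in> I \<and> e i = k} \<and> c i = r} = {i. i \<in> {i \<in> I. c i = r} \<and> e i = k}" for r
    by auto
  ultimately show "fps_nth (wsum I w e) k = fps_nth (\<Sum>r\<in>R. wsum {i \<in> I. c i = r} w e) k"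
    by (simp add: wsum_nth fps_sum_nth)
qed

lemma theta_mult:
  assumes "a + b > 0" "a' + b' > 0"
  shows "theta s a b * theta t a' b' = wsum UNIV (\<lambda>(x, y). s ^ nat \<bar>x\<bar> * t ^ nat \<bar>y\<bar>)
    (\<lambda>(x, y). theta_exp a b x + theta_exp a' b' y)"
  unfolding theta_def
  by (subst wsum_mult) (use finite_theta_exp[OF assms(1)] finite_theta_exp[OF assms(2)] in \<open>auto simp: case_prod_unfold\<close>)

lemma finite_theta_exp_pair:
  assumes "a + b > 0" "a' + b' > 0"
  shows "finite {p. p \<in> UNIV \<and> (\<lambda>(x, y). theta_exp a b x + theta_exp a' b' y) p = k}"
  using finite_fibres_times[of UNIV "theta_exp a b" UNIV "theta_exp a' b'" k]
    finite_theta_exp[OF assms(1)] finite_theta_exp[OF assms(2)]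
  by (simp add: case_prod_beta)

lemma minus_one_power_nat_abs: "(- 1 :: rat) ^ nat \<bar>j\<bar> = (if even j then 1 else - 1)"
  by (cases "even j") (auto simp: even_nat_iff)

section \<open>Theta series as eta quotients\<close>

lemma prod_lessThan_mult:
  fixes f :: "nat \<Rightarrow> 'a :: comm_monoid_mult"
  shows "(\<Prod>i<k * N. f i) = (\<Prod>r<k. \<Prod>i<N. f (k * i + r))"
proof (induction N)
  case (Suc N)
  have "(\<Prod>i<m + k. f i) = (\<Prod>i<m. f i) * (\<Prod>r<k. f (m + r))" for m k
    by (induction k) (auto simp: mult_ac)
  from this[of "k * N" k] show ?case
    using Suc by (simp add: prod.distrib add.commute)
qed auto

text \<open>Sorting the factors by their index modulo \<open>k\<close> splits a progression of
  exponents into \<open>k\<close> progressions with \<open>k\<close> times the difference.\<close>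

lemma qpoch_split: "qpoch s a d (k * N) = (\<Prod>r<k. qpoch s (a + d * r) (d * k) N)"
  unfolding qpoch_def prod_lessThan_mult by (simp add: algebra_simps)

lemma euler_fin_eq_qpoch: "euler_fin m N = qpoch (- 1) m m N"
  unfolding euler_fin_def qpoch_def by (simp flip: fps_const_neg)

lemma qpoch_mult_minus: "qpoch 1 a d N * qpoch (- 1) a d N = qpoch (- 1) (2 * a) (2 * d) N"
proof -
  have "fps_X ^ (2 * a + 2 * d * i) = ((fps_X :: rat fps) ^ (a + d * i)) ^ 2" for i
    by (simp add: algebra_simps flip: power_mult)
  then show ?thesis
    unfolding qpoch_def prod.distrib [symmetric]
    by (intro prod.cong refl) (simp add: power2_eq_square algebra_simps flip: fps_const_neg)
qed

lemma euler_fin_split_2: "euler_fin m (2 * N) = qpoch (- 1) m (2 * m) N * euler_fin (2 * m) N"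
  unfolding euler_fin_eq_qpoch qpoch_split by (simp add: numeral_2_eq_2 mult.commute)

lemma euler_fin_subseq_LIMSEQ:
  assumes "m > 0" "c > 0"
  shows "(\<lambda>N. euler_fin m (c * N)) \<longlonglongrightarrow> euler_f m"
  using LIMSEQ_subseq_LIMSEQ[OF euler_fin_LIMSEQ[OF assms(1)], of "\<lambda>N. c * N"] assms
  by (simp add: strict_mono_def o_def)

lemmas euler_LIMSEQ_intros = tendsto_mult_fps tendsto_power_fps euler_fin_LIMSEQ euler_fin_subseq_LIMSEQ

lemma prod_lessThan_3: "(\<Prod>r<3. f r) = f 0 * f 1 * f (2 :: nat)" for f :: "nat \<Rightarrow> 'a :: comm_monoid_mult"
  by (simp add: numeral_eq_Suc)

lemma LIMSEQ_eqI: "(\<And>N. f N = g N) \<Longrightarrow> g \<longlonglongrightarrow> l \<Longrightarrow> f \<longlonglongrightarrow> l"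
  by presburger

text \<open>Euler's pentagonal number theorem: the classes of \<open>m\<close>, \<open>2 m\<close>
  and \<open>3 m\<close> modulo \<open>3 m\<close> exhaust the multiples of
  \<open>m\<close>.\<close>

lemma theta_pentagonal:
  assumes "m > 0"
  shows "theta (- 1) m (2 * m) = euler_f m"
proof (rule LIMSEQ_unique)
  have "qpoch (- 1) m (m + 2 * m) N * qpoch (- 1) (2 * m) (m + 2 * m) N * euler_fin (m + 2 * m) N
      = euler_fin m (3 * N)" for N
  proof -
    have m: "m * 3 = m + 2 * m" "m + m * 0 = m" "m + m * 1 = 2 * m" "m + m * 2 = m + 2 * m" by auto
    show ?thesis
      unfolding euler_fin_eq_qpoch qpoch_split prod_lessThan_3 m ..
  qed
  moreover have "(\<lambda>N. euler_fin m (3 * N)) \<longlonglongrightarrow> euler_f m"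
    using assms by (intro euler_fin_subseq_LIMSEQ) auto
  ultimately show "(\<lambda>N. qpoch (- 1) m (m + 2 * m) N * qpoch (- 1) (2 * m) (m + 2 * m) N * euler_fin (m + 2 * m) N)
      \<longlonglongrightarrow> euler_f m" by simp
qed (use assms in \<open>intro jacobi_triple_product; simp\<close>)

text \<open>The product for \<open>phi(-q^m)\<close>: its odd multiples of \<open>m\<close> occur
  twice, and one more factor \<open>f_(2m)\<close> completes both copies to
  \<open>f_m\<close>.\<close>

lemma theta_minus_diag:
  assumes "m > 0"
  shows "theta (- 1) m m * euler_f (2 * m) = euler_f m ^ 2"
proof (rule LIMSEQ_unique)
  show "(\<lambda>N. qpoch (- 1) m (m + m) N * qpoch (- 1) m (m + m) N * euler_fin (m + m) N * euler_fin (2 * m) N)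
      \<longlonglongrightarrow> theta (- 1) m m * euler_f (2 * m)"
    using assms by (intro euler_LIMSEQ_intros jacobi_triple_product) auto
  have "qpoch (- 1) m (m + m) N * qpoch (- 1) m (m + m) N * euler_fin (m + m) N * euler_fin (2 * m) N
      = euler_fin m (2 * N) ^ 2" for N
    unfolding euler_fin_split_2 mult_2 [symmetric] power2_eq_square by (simp only: mult_ac)
  moreover have "(\<lambda>N. euler_fin m (2 * N) ^ 2) \<longlonglongrightarrow> euler_f m ^ 2"
    using assms by (intro euler_LIMSEQ_intros) auto
  ultimately show "(\<lambda>N. qpoch (- 1) m (m + m) N * qpoch (- 1) m (m + m) N * euler_fin (m + m) N * euler_fin (2 * m) N)
      \<longlonglongrightarrow> euler_f m ^ 2" by simp
qed

text \<open>The product for \<open>phi(q^m)\<close>: its factors \<open>1 + q^(m(2i+1))\<close> pair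
  with the factors \<open>1 - q^(m(2i+1))\<close> of \<open>f_m\<close>, and \<open>f_(4m)\<close>
  completes the result to \<open>f_(2m)\<close>.\<close>

lemma theta_plus_diag:
  assumes "m > 0"
  shows "theta 1 m m * (euler_f m ^ 2 * euler_f (4 * m) ^ 2) = euler_f (2 * m) ^ 5"
proof (rule LIMSEQ_unique)
  define L where "L = (\<lambda>N. qpoch 1 m (m + m) N * qpoch 1 m (m + m) N * euler_fin (m + m) N *
      (euler_fin m (2 * N) ^ 2 * euler_fin (4 * m) N ^ 2))"
  show "L \<longlonglongrightarrow> theta 1 m m * (euler_f m ^ 2 * euler_f (4 * m) ^ 2)"
    unfolding L_def using assms by (intro euler_LIMSEQ_intros jacobi_triple_product) auto
  have "L N = euler_fin (2 * m) (2 * N) ^ 2 * euler_fin (2 * m) N ^ 3" for N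
  proof -
    have "L N = (qpoch 1 m (2 * m) N * qpoch (- 1) m (2 * m) N * euler_fin (4 * m) N) ^ 2 * euler_fin (2 * m) N ^ 3"
      unfolding L_def euler_fin_split_2 mult_2 [symmetric] by (simp add: power2_eq_square power3_eq_cube mult_ac)
    then show ?thesis
      unfolding qpoch_mult_minus using euler_fin_split_2[of "2 * m" N] by simp
  qed
  moreover have "(\<lambda>N. euler_fin (2 * m) (2 * N) ^ 2 * euler_fin (2 * m) N ^ 3) \<longlonglongrightarrow> euler_f (2 * m) ^ (2 + 3)"
    unfolding power_add using assms by (intro euler_LIMSEQ_intros) auto
  then have "(\<lambda>N. euler_fin (2 * m) (2 * N) ^ 2 * euler_fin (2 * m) N ^ 3) \<longlonglongrightarrow> euler_f (2 * m) ^ 5"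
    by simp
  ultimately show "L \<longlonglongrightarrow> euler_f (2 * m) ^ 5" by (rule LIMSEQ_eqI)
qed

text \<open>The product for \<open>2 psi(q^m)\<close>; the 2 is the initial factor
  \<open>1 + q^0\<close>.\<close>

lemma theta_triangular:
  assumes "m > 0"
  shows "theta 1 0 m * euler_f m = 2 * euler_f (2 * m) ^ 2"
proof (rule LIMSEQ_unique)
  \<comment> \<open>The additional factor \<open>1 + q^(m N)\<close> tends to 1. It prolongs the
    first product by one term, so that splitting off \<open>1 + q^0 = 2\<close> leaves exactly
    \<open>qpoch 1 m m N\<close>.\<close>
  define L where "L = (\<lambda>N. qpoch 1 0 (0 + m) N * qpoch 1 m (0 + m) N * euler_fin (0 + m) N *
      ((1 + fps_X ^ (m * N)) * euler_fin m N))"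
  have "(\<lambda>N. 1 + fps_X ^ (m * N) :: rat fps) \<longlonglongrightarrow> 1"
  proof (rule tendsto_fpsI)
    fix k
    show "\<forall>\<^sub>F N in sequentially. fps_nth (1 + fps_X ^ (m * N) :: rat fps) k = fps_nth 1 k"
      using eventually_gt_at_top[of k]
    proof eventually_elim
      case (elim N)
      moreover have "N \<le> m * N" using assms by simp
      ultimately have "k \<noteq> m * N" by linarith
      then show ?case by simp
    qed
  qed
  then have "L \<longlonglongrightarrow> theta 1 0 m * (1 * euler_f m)"
    unfolding L_def using assms by (intro euler_LIMSEQ_intros jacobi_triple_product) auto
  then show "L \<longlonglongrightarrow> theta 1 0 m * euler_f m" by simp
  have "L N = 2 * euler_fin (2 * m) N ^ 2" for N
  proof -
    have "qpoch 1 0 m N * (1 + fps_X ^ (m * N)) = qpoch 1 0 m (Suc N)"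
      by (simp add: qpoch_def)
    also have "\<dots> = 2 * qpoch 1 m m N"
      unfolding qpoch_def by (subst prod.lessThan_Suc_shift) simp
    finally have 1: "qpoch 1 0 m N * (1 + fps_X ^ (m * N)) = 2 * qpoch 1 m m N" .
    have "L N = (qpoch 1 0 m N * (1 + fps_X ^ (m * N))) * qpoch 1 m m N * euler_fin m N ^ 2"
      unfolding L_def by (simp add: power2_eq_square mult_ac)
    also have "\<dots> = 2 * (qpoch 1 m m N * qpoch (- 1) m m N) ^ 2"
      unfolding 1 euler_fin_eq_qpoch by (simp add: power2_eq_square mult_ac)
    finally show ?thesis
      unfolding qpoch_mult_minus by (simp add: euler_fin_eq_qpoch)
  qed
  moreover have "(\<lambda>N. 2 * euler_fin (2 * m) N ^ 2) \<longlonglongrightarrow> 2 * euler_f (2 * m) ^ 2"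
    using assms by (intro euler_LIMSEQ_intros tendsto_const) auto
  ultimately show "L \<longlonglongrightarrow> 2 * euler_f (2 * m) ^ 2" by (rule LIMSEQ_eqI)
qed

lemma prod_lessThan_5: "(\<Prod>r<5. f r) = f 0 * f 1 * f 2 * f 3 * f (4 :: nat)" for f :: "nat \<Rightarrow> 'a :: comm_monoid_mult"
  by (simp add: numeral_eq_Suc)

text \<open>\<open>f_1 / f_2\<close> keeps the odd exponents and \<open>f_5 / f_10\<close> is its
  part at multiples of 5; what remains are the residues 1, 9 and 3, 7 modulo 10.\<close>

lemma theta_level_10_odd:
  "theta (- 1) 1 9 * theta (- 1) 3 7 * (euler_f 2 * euler_f 5) = euler_f 1 * euler_f 10 ^ 3"
proof (rule LIMSEQ_unique)
  define L where "L = (\<lambda>N. qpoch (- 1) 1 (1 + 9) N * qpoch (- 1) 9 (1 + 9) N * euler_fin (1 + 9) N *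
      (qpoch (- 1) 3 (3 + 7) N * qpoch (- 1) 7 (3 + 7) N * euler_fin (3 + 7) N) *
      (euler_fin 2 (5 * N) * euler_fin 5 (2 * N)))"
  show "L \<longlonglongrightarrow> theta (- 1) 1 9 * theta (- 1) 3 7 * (euler_f 2 * euler_f 5)"
    unfolding L_def by (intro euler_LIMSEQ_intros jacobi_triple_product) auto
  have "L N = euler_fin 1 (10 * N) * euler_fin 10 N ^ 3" for N
  proof -
    have "euler_fin 1 (10 * N) = qpoch (- 1) 1 2 (5 * N) * euler_fin 2 (5 * N)"
      using euler_fin_split_2[of 1 "5 * N"] by simp
    also have "qpoch (- 1) 1 2 (5 * N) = qpoch (- 1) 1 10 N * qpoch (- 1) 3 10 N * qpoch (- 1) 5 10 N
        * qpoch (- 1) 7 10 N * qpoch (- 1) 9 10 N"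
      unfolding qpoch_split prod_lessThan_5 by (simp del: One_nat_def)
    finally have 1: "euler_fin 1 (10 * N) = \<dots> * euler_fin 2 (5 * N)" .
    have 2: "euler_fin 5 (2 * N) = qpoch (- 1) 5 10 N * euler_fin 10 N"
      using euler_fin_split_2[of 5 N] by simp
    show ?thesis
      unfolding L_def 1 2 by (simp add: power3_eq_cube mult_ac)
  qed
  moreover have "(\<lambda>N. euler_fin 1 (10 * N) * euler_fin 10 N ^ 3) \<longlonglongrightarrow> euler_f 1 * euler_f 10 ^ 3"
    by (intro euler_LIMSEQ_intros) auto
  ultimately show "L \<longlonglongrightarrow> euler_f 1 * euler_f 10 ^ 3" by (rule LIMSEQ_eqI)
qed

text \<open>\<open>f_2 / f_1\<close> is the product of all \<open>1 + q^n\<close>, and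
  \<open>f_10 / f_5\<close> is its part at multiples of 5; what remains are the residues 1, 4 and 2,
  3 modulo 5.\<close>

lemma theta_level_5:
  "theta 1 1 4 * theta 1 2 3 * (euler_f 1 * euler_f 10) = euler_f 2 * euler_f 5 ^ 3"
proof (rule LIMSEQ_unique)
  define L where "L = (\<lambda>N. qpoch 1 1 (1 + 4) N * qpoch 1 4 (1 + 4) N * euler_fin (1 + 4) N *
      (qpoch 1 2 (2 + 3) N * qpoch 1 3 (2 + 3) N * euler_fin (2 + 3) N) *
      (euler_fin 1 (5 * N) * euler_fin 10 N))"
  show "L \<longlonglongrightarrow> theta 1 1 4 * theta 1 2 3 * (euler_f 1 * euler_f 10)"
    unfolding L_def by (intro euler_LIMSEQ_intros jacobi_triple_product) auto
  have "L N = euler_fin 2 (5 * N) * euler_fin 5 N ^ 3" for N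
  proof -
    have "euler_fin 2 (5 * N) = qpoch 1 1 1 (5 * N) * euler_fin 1 (5 * N)"
      using qpoch_mult_minus[of 1 1 "5 * N"] by (simp add: euler_fin_eq_qpoch)
    also have "qpoch 1 1 1 (5 * N) = qpoch 1 1 5 N * qpoch 1 2 5 N * qpoch 1 3 5 N
        * qpoch 1 4 5 N * qpoch 1 5 5 N"
      unfolding qpoch_split prod_lessThan_5 by (simp del: One_nat_def)
    finally have 1: "euler_fin 2 (5 * N) = \<dots> * euler_fin 1 (5 * N)" .
    have 2: "euler_fin 10 N = qpoch 1 5 5 N * euler_fin 5 N"
      using qpoch_mult_minus[of 5 5 N] by (simp add: euler_fin_eq_qpoch)
    show ?thesis
      unfolding L_def 1 2 by (simp add: power3_eq_cube mult_ac)
  qed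
  moreover have "(\<lambda>N. euler_fin 2 (5 * N) * euler_fin 5 N ^ 3) \<longlonglongrightarrow> euler_f 2 * euler_f 5 ^ 3"
    by (intro euler_LIMSEQ_intros) auto
  ultimately show "L \<longlonglongrightarrow> euler_f 2 * euler_f 5 ^ 3" by (rule LIMSEQ_eqI)
qed

section \<open>Theta identities from sublattices\<close>

text \<open>The exponents in \<open>phi(-q)^2\<close> are norms of Gaussian integers
  \<open>x + i y\<close>, and \<open>x + 2 y\<close> modulo 5 is the residue modulo
  \<open>1 + 2 i\<close>. The ideal gives \<open>phi(-q^5)^2\<close>; the four nonzero classes
  contribute equally.\<close>

lemma theta_square_level_5:
  "theta (- 1) 1 1 ^ 2 = theta (- 1) 5 5 ^ 2 - 4 * fps_X * (theta (- 1) 1 9 * theta (- 1) 3 7)"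
proof -
  define w :: "int \<times> int \<Rightarrow> rat" where "w = (\<lambda>(x, y). (- 1) ^ nat \<bar>x\<bar> * (- 1) ^ nat \<bar>y\<bar>)"
  define e where "e = (\<lambda>(x, y). theta_exp 1 1 x + theta_exp 1 1 y)"
  define c :: "int \<times> int \<Rightarrow> int" where "c = (\<lambda>(x, y). (x + 2 * y) mod 5)"
  define S where "S r = wsum {p \<in> UNIV. c p = r} w e" for r
  have w: "w (x, y) = (if even (x + y) then 1 else - 1)" for x y
    by (auto simp: w_def minus_one_power_nat_abs)
  have e: "2 * int (e (x, y)) = 2 * x\<^sup>2 + 2 * y\<^sup>2" for x y
    by (simp add: e_def theta_exp_int)
  have "theta (- 1) 1 1 ^ 2 = wsum UNIV w e"
    unfolding power2_eq_square w_def e_def by (rule theta_mult) auto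
  also have "\<dots> = (\<Sum>r\<in>{0, 1, 2, 3, 4}. S r)"
    unfolding S_def
  proof (rule wsum_partition)
    show "finite {p. p \<in> UNIV \<and> e p = k}" for k
      unfolding e_def by (rule finite_theta_exp_pair) auto
    show "c p \<in> {0, 1, 2, 3, 4}" for p
    proof -
      have "c p \<in> {0..<5}" by (auto simp: c_def case_prod_beta)
      also have "{0..<5 :: int} = {0, 1, 2, 3, 4}" by auto
      finally show ?thesis .
    qed
  qed auto
  also have "\<dots> = S 0 + S 1 + S 2 + S 3 + S 4"
    by (simp add: add_ac)
  finally have sum: "theta (- 1) 1 1 ^ 2 = S 0 + S 1 + S 2 + S 3 + S 4" .
  \<comment> \<open>Multiplication by \<open>i\<close> keeps the norm and the parity of
    \<open>x + y\<close>, and doubles the class since \<open>2 x - y = 2 (x + 2 y) - 5 y\<close>.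
    Its inverse multiplies the class by 3.\<close>
  have rot: "S r' = S r" if r': "r' = (2 * r) mod 5" and r: "r \<in> {0..<5}" for r r'
    unfolding S_def
  proof (rule wsum_reindex[where h = "\<lambda>(x, y). (- y, x)" and g = "\<lambda>(x, y). (y, - x)"])
    show "(case p of (x, y) \<Rightarrow> (- y, x)) \<in> {p \<in> UNIV. c p = r'}" if "p \<in> {p \<in> UNIV. c p = r}" for p
    proof -
      obtain x y where p: "p = (x, y)" by (cases p)
      from that have "r = (x + 2 * y) mod 5" by (simp add: c_def p)
      then have "(2 * (x + 2 * y) + 5 * - y) mod 5 = r'"
        unfolding r' mod_mult_self2 by (simp only: mod_mult_right_eq)
      then have "(- y + 2 * x) mod 5 = r'" by (simp add: algebra_simps)
      then show ?thesis by (simp add: c_def p)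
    qed
    show "(case p of (x, y) \<Rightarrow> (y, - x)) \<in> {p \<in> UNIV. c p = r}" if "p \<in> {p \<in> UNIV. c p = r'}" for p
    proof -
      obtain x y where p: "p = (x, y)" by (cases p)
      from that have "(x + 2 * y) mod 5 = r'" by (simp add: c_def p)
      then have "(3 * (x + 2 * y) + 5 * (- x - y)) mod 5 = (3 * r') mod 5"
        unfolding mod_mult_self2 by (metis mod_mult_right_eq)
      moreover have "r \<in> {0, 1, 2, 3, 4}" using r by auto
      then have "(3 * r') mod 5 = r" unfolding r' by auto
      ultimately have "(y + 2 * - x) mod 5 = r" by (simp add: algebra_simps)
      then show ?thesis by (simp add: c_def p)
    qed
    show "e (case p of (x, y) \<Rightarrow> (- y, x)) = e p" for p
      by (cases p; rule nat_eqI_double) (simp add: e)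
  qed (auto simp: w)
  \<comment> \<open>Doubling modulo 5 runs through 1, 2, 4, 3.\<close>
  have S2: "S 2 = S 1" and S4: "S 4 = S 1" and S3: "S 3 = S 1"
    using rot[of 2 1] rot[of 4 2] rot[of 3 4] by auto
  have S0: "S 0 = theta (- 1) 5 5 ^ 2"
  proof -
    have "theta (- 1) 5 5 ^ 2 = wsum UNIV w (\<lambda>(x, y). theta_exp 5 5 x + theta_exp 5 5 y)"
      unfolding power2_eq_square w_def by (rule theta_mult) auto
    moreover have "S 0 = wsum UNIV w (\<lambda>(x, y). theta_exp 5 5 x + theta_exp 5 5 y)"
      unfolding S_def
    \<comment> \<open>\<open>h\<close> multiplies \<open>a + i b\<close> by \<open>1 + 2 i\<close>,
      which multiplies the norm by 5.\<close>
    proof (rule wsum_reindex[where h = "\<lambda>(a, b). (a - 2 * b, 2 * a + b)"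
          and g = "\<lambda>(x, y). ((x + 2 * y) div 5, y - 2 * ((x + 2 * y) div 5))"])
      show "(case p of (a, b) \<Rightarrow> (a - 2 * b, 2 * a + b)) \<in> {p \<in> UNIV. c p = 0}" for p
        by (cases p) (auto simp: c_def)
      show "(case case p of (x, y) \<Rightarrow> ((x + 2 * y) div 5, y - 2 * ((x + 2 * y) div 5)) of
          (a, b) \<Rightarrow> (a - 2 * b, 2 * a + b)) = p" if "p \<in> {p \<in> UNIV. c p = 0}" for p
      proof -
        obtain x y where p: "p = (x, y)" by (cases p)
        from that have "(x + 2 * y) mod 5 = 0" by (simp add: c_def p)
        moreover define k where "k = (x + 2 * y) div 5"
        ultimately have "x + 2 * y = 5 * k + 0"
          using mult_div_mod_eq[of 5 "x + 2 * y"] by simp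
        then show ?thesis
          unfolding p prod.case prod.inject k_def [symmetric] by presburger
      qed
      show "e (case p of (a, b) \<Rightarrow> (a - 2 * b, 2 * a + b)) = (case p of (x, y) \<Rightarrow> theta_exp 5 5 x + theta_exp 5 5 y)" for p
      proof (cases p)
        case (Pair a b)
        have "2 * int (e (a - 2 * b, 2 * a + b)) = 2 * int (theta_exp 5 5 a + theta_exp 5 5 b)"
          unfolding e of_nat_add distrib_left[of "2 :: int" "int _"] theta_exp_int
          by (simp add: algebra_simps power2_eq_square)
        then show ?thesis by (simp add: Pair)
      qed
    qed (auto simp: w)
    ultimately show ?thesis by simp
  qed
  have S1: "S 1 = - (fps_X * (theta (- 1) 1 9 * theta (- 1) 3 7))"
  proof -
    have "theta (- 1) 1 9 * theta (- 1) 3 7 = wsum UNIV w (\<lambda>(x, y). theta_exp 1 9 x + theta_exp 3 7 y)"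
      unfolding w_def by (rule theta_mult) auto
    moreover have "S 1 = wsum UNIV (\<lambda>p. - w p) (\<lambda>p. 1 + (case p of (x, y) \<Rightarrow> theta_exp 1 9 x + theta_exp 3 7 y))"
      unfolding S_def
    \<comment> \<open>The points \<open>1 + (-2 + i)(m + i n)\<close>, where
      \<open>-2 + i = i (1 + 2 i)\<close>. Their norm separates as
      \<open>1 + (5 m^2 - 4 m) + (5 n^2 - 2 n)\<close>; the offset 1 accounts for the factor
      \<open>q\<close> and for the sign.\<close>
    proof (rule wsum_reindex[where h = "\<lambda>(m, n). (1 - 2 * m - n, m - 2 * n)"
          and g = "\<lambda>(x, y). (y - 2 * ((x + 2 * y) div 5), - ((x + 2 * y) div 5))"])
      show "(case p of (m, n) \<Rightarrow> (1 - 2 * m - n, m - 2 * n)) \<in> {p \<in> UNIV. c p = 1}" for p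
      proof (cases p)
        case (Pair m n)
        have s: "1 - 2 * m - n + 2 * (m - 2 * n) = 1 + 5 * (- n)" by simp
        have "(1 - 2 * m - n + 2 * (m - 2 * n)) mod 5 = 1" unfolding s mod_mult_self2 by simp
        then show ?thesis by (simp only: c_def Pair prod.case mem_Collect_eq UNIV_I simp_thms)
      qed
      show "(case case p of (x, y) \<Rightarrow> (y - 2 * ((x + 2 * y) div 5), - ((x + 2 * y) div 5)) of
          (m, n) \<Rightarrow> (1 - 2 * m - n, m - 2 * n)) = p" if "p \<in> {p \<in> UNIV. c p = 1}" for p
      proof -
        obtain x y where p: "p = (x, y)" by (cases p)
        from that have "(x + 2 * y) mod 5 = 1" by (simp add: c_def p)
        moreover define k where "k = (x + 2 * y) div 5"
        ultimately have "x + 2 * y = 5 * k + 1"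
          using mult_div_mod_eq[of 5 "x + 2 * y"] by simp
        then show ?thesis
          unfolding p prod.case prod.inject k_def [symmetric] by presburger
      qed
      show "(case case p of (m, n) \<Rightarrow> (1 - 2 * m - n, m - 2 * n) of
          (x, y) \<Rightarrow> (y - 2 * ((x + 2 * y) div 5), - ((x + 2 * y) div 5))) = p" for p :: "int \<times> int"
      proof (cases p)
        case (Pair m n)
        have s: "1 - 2 * m - n + 2 * (m - 2 * n) = 1 + 5 * (- n)" by simp
        have "(1 - 2 * m - n + 2 * (m - 2 * n)) div 5 = - n" unfolding s by (subst div_mult_self2) auto
        then show ?thesis unfolding Pair prod.case by (simp only:) simp
      qed
      show "e (case p of (m, n) \<Rightarrow> (1 - 2 * m - n, m - 2 * n))
          = 1 + (case p of (x, y) \<Rightarrow> theta_exp 1 9 x + theta_exp 3 7 y)" for p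
      proof (cases p)
        case (Pair m n)
        have "2 * int (e (1 - 2 * m - n, m - 2 * n)) = 2 * int (1 + (theta_exp 1 9 m + theta_exp 3 7 n))"
          unfolding e of_nat_add distrib_left[of "2 :: int" "int _"] theta_exp_int
          by (simp add: algebra_simps power2_eq_square)
        then show ?thesis by (simp add: Pair)
      qed
      show "w (case p of (m, n) \<Rightarrow> (1 - 2 * m - n, m - 2 * n)) = - w p" for p
      proof (cases p)
        case (Pair m n)
        have "even (1 - 2 * m - n + (m - 2 * n)) \<longleftrightarrow> odd (m + n)" by presburger
        then show ?thesis by (simp only: Pair prod.case w) simp
      qed
    qed auto
    ultimately show ?thesis by (simp add: wsum_X_mult wsum_uminus)
  qed
  show ?thesis
    unfolding sum S2 S3 S4 S0 S1 by simp
qed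

text \<open>
  With \<open>X = 2 x - 1\<close> and \<open>Y = 2 y - 1\<close> the exponent on the left is \<open>(X^2 + Y^2 - 2) / 8\<close>, so that the
  rotation \<open>(X, Y) \<mapsto> (-Y, X)\<close> becomes \<open>(x, y) \<mapsto> (1 - y, x)\<close>, and the
  sublattice \<open>X + 2 Y \<equiv> 0\<close> modulo 5 becomes the class \<open>x + 2 y \<equiv> 4\<close>.
\<close>

lemma theta_triangular_square_level_5:
  "theta 1 0 1 ^ 2 = fps_X * theta 1 0 5 ^ 2 + 4 * (theta 1 1 4 * theta 1 2 3)"
proof -
  define w :: "int \<times> int \<Rightarrow> rat" where "w = (\<lambda>(x, y). 1 ^ nat \<bar>x\<bar> * 1 ^ nat \<bar>y\<bar>)"
  define e where "e = (\<lambda>(x, y). theta_exp 0 1 x + theta_exp 0 1 y)"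
  define c :: "int \<times> int \<Rightarrow> int" where "c = (\<lambda>(x, y). (x + 2 * y) mod 5)"
  define S where "S r = wsum {p \<in> UNIV. c p = r} w e" for r
  have w: "w p = 1" for p
    by (auto simp: w_def case_prod_beta)
  have e: "2 * int (e (x, y)) = x\<^sup>2 - x + (y\<^sup>2 - y)" for x y
    unfolding e_def prod.case of_nat_add distrib_left theta_exp_int by simp
  have "theta 1 0 1 ^ 2 = wsum UNIV w e"
    unfolding power2_eq_square w_def e_def by (rule theta_mult) auto
  also have "\<dots> = (\<Sum>r\<in>{0, 1, 2, 3, 4}. S r)"
    unfolding S_def
  proof (rule wsum_partition)
    show "finite {p. p \<in> UNIV \<and> e p = k}" for k
      unfolding e_def by (rule finite_theta_exp_pair) auto
    show "c p \<in> {0, 1, 2, 3, 4}" for p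
    proof -
      have "c p \<in> {0..<5}" by (auto simp: c_def case_prod_beta)
      also have "{0..<5 :: int} = {0, 1, 2, 3, 4}" by auto
      finally show ?thesis .
    qed
  qed auto
  also have "\<dots> = S 0 + S 1 + S 2 + S 3 + S 4"
    by (simp add: add_ac)
  finally have sum: "theta 1 0 1 ^ 2 = S 0 + S 1 + S 2 + S 3 + S 4" .
  \<comment> \<open>On classes the rotation is \<open>r -> 2 r + 1\<close>, which fixes 4 and
    permutes the others cyclically as 0, 1, 3, 2.\<close>
  have rot: "S r' = S r" if r': "r' = (2 * r + 1) mod 5" and r: "r \<in> {0..<5}" for r r'
    unfolding S_def
  proof (rule wsum_reindex[where h = "\<lambda>(x, y). (1 - y, x)" and g = "\<lambda>(x, y). (y, 1 - x)"])
    show "(case p of (x, y) \<Rightarrow> (1 - y, x)) \<in> {p \<in> UNIV. c p = r'}" if "p \<in> {p \<in> UNIV. c p = r}" for p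
    proof -
      obtain x y where p: "p = (x, y)" by (cases p)
      from that have "r = (x + 2 * y) mod 5" by (simp add: c_def p)
      then have "(2 * (x + 2 * y) + 1 + 5 * - y) mod 5 = r'"
        unfolding r' mod_mult_self2 by (metis mod_add_left_eq mod_mult_right_eq)
      then have "(1 - y + 2 * x) mod 5 = r'" by (simp add: algebra_simps)
      then show ?thesis by (simp add: c_def p)
    qed
    show "(case p of (x, y) \<Rightarrow> (y, 1 - x)) \<in> {p \<in> UNIV. c p = r}" if "p \<in> {p \<in> UNIV. c p = r'}" for p
    proof -
      obtain x y where p: "p = (x, y)" by (cases p)
      from that have "(x + 2 * y) mod 5 = r'" by (simp add: c_def p)
      then have "(3 * (x + 2 * y) + 2 + 5 * (- x - y)) mod 5 = (3 * r' + 2) mod 5"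
        unfolding mod_mult_self2 by (metis mod_add_left_eq mod_mult_right_eq)
      moreover have "r \<in> {0, 1, 2, 3, 4}" using r by auto
      then have "(3 * r' + 2) mod 5 = r" unfolding r' by auto
      ultimately have "(y + 2 * (1 - x)) mod 5 = r" by (simp add: algebra_simps)
      then show ?thesis by (simp add: c_def p)
    qed
    show "e (case p of (x, y) \<Rightarrow> (1 - y, x)) = e p" for p
      by (cases p; rule nat_eqI_double) (simp add: e power2_eq_square algebra_simps)
  qed (auto simp: w)
  have S1: "S 1 = S 0" and S3: "S 3 = S 0" and S2: "S 2 = S 0"
    using rot[of 1 0] rot[of 3 1] rot[of 2 3] by auto
  have S4: "S 4 = fps_X * theta 1 0 5 ^ 2"
  proof -
    have "theta 1 0 5 ^ 2 = wsum UNIV w (\<lambda>(x, y). theta_exp 0 5 x + theta_exp 0 5 y)"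
      unfolding power2_eq_square w_def by (rule theta_mult) auto
    moreover have "S 4 = wsum UNIV w (\<lambda>p. 1 + (case p of (x, y) \<Rightarrow> theta_exp 0 5 x + theta_exp 0 5 y))"
      unfolding S_def
    \<comment> \<open>In the odd coordinates, with \<open>A = 2 a - 1\<close> and
      \<open>B = 2 b - 1\<close>, this is multiplication by \<open>1 + 2 i\<close>. The factor
      \<open>q\<close> arises from
      \<open>(5 (A^2 + B^2) - 2) / 8 = 1 + 5 (A^2 + B^2 - 2) / 8\<close>.\<close>
    proof (rule wsum_reindex[where h = "\<lambda>(a, b). (a - 2 * b + 1, 2 * a + b - 1)"
          and g = "\<lambda>(x, y). ((x + 2 * y) div 5 + 1, y - 2 * ((x + 2 * y) div 5) - 1)"])
      show "(case p of (a, b) \<Rightarrow> (a - 2 * b + 1, 2 * a + b - 1)) \<in> {p \<in> UNIV. c p = 4}" for p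
      proof (cases p)
        case (Pair a b)
        have s: "a - 2 * b + 1 + 2 * (2 * a + b - 1) = 4 + 5 * (a - 1)" by simp
        have "(a - 2 * b + 1 + 2 * (2 * a + b - 1)) mod 5 = 4" unfolding s mod_mult_self2 by simp
        then show ?thesis by (simp only: c_def Pair prod.case mem_Collect_eq UNIV_I simp_thms)
      qed
      show "(case case p of (x, y) \<Rightarrow> ((x + 2 * y) div 5 + 1, y - 2 * ((x + 2 * y) div 5) - 1) of
          (a, b) \<Rightarrow> (a - 2 * b + 1, 2 * a + b - 1)) = p" if "p \<in> {p \<in> UNIV. c p = 4}" for p
      proof -
        obtain x y where p: "p = (x, y)" by (cases p)
        from that have "(x + 2 * y) mod 5 = 4" by (simp add: c_def p)
        moreover define k where "k = (x + 2 * y) div 5"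
        ultimately have "x + 2 * y = 5 * k + 4"
          using mult_div_mod_eq[of 5 "x + 2 * y"] by simp
        then show ?thesis
          unfolding p prod.case prod.inject k_def [symmetric] by presburger
      qed
      show "(case case p of (a, b) \<Rightarrow> (a - 2 * b + 1, 2 * a + b - 1) of
          (x, y) \<Rightarrow> ((x + 2 * y) div 5 + 1, y - 2 * ((x + 2 * y) div 5) - 1)) = p" for p :: "int \<times> int"
      proof (cases p)
        case (Pair a b)
        have s: "a - 2 * b + 1 + 2 * (2 * a + b - 1) = 4 + 5 * (a - 1)" by simp
        have "(a - 2 * b + 1 + 2 * (2 * a + b - 1)) div 5 = a - 1" unfolding s by (subst div_mult_self2) auto
        then show ?thesis unfolding Pair prod.case by (simp only:) simp
      qed
      show "e (case p of (a, b) \<Rightarrow> (a - 2 * b + 1, 2 * a + b - 1))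
          = 1 + (case p of (x, y) \<Rightarrow> theta_exp 0 5 x + theta_exp 0 5 y)" for p
      proof (cases p)
        case (Pair a b)
        have "2 * int (e (a - 2 * b + 1, 2 * a + b - 1)) = 2 * int (1 + (theta_exp 0 5 a + theta_exp 0 5 b))"
          unfolding e of_nat_add distrib_left[of "2 :: int" "int _"] theta_exp_int
          by (simp add: algebra_simps power2_eq_square)
        then show ?thesis by (simp add: Pair)
      qed
    qed (auto simp: w)
    ultimately show ?thesis by (simp add: wsum_X_mult)
  qed
  have S0: "S 0 = theta 1 1 4 * theta 1 2 3"
  proof -
    have "theta 1 1 4 * theta 1 2 3 = wsum UNIV w (\<lambda>(x, y). theta_exp 1 4 x + theta_exp 2 3 y)"
      unfolding w_def by (rule theta_mult) auto
    moreover have "S 0 = wsum UNIV w (\<lambda>(x, y). theta_exp 1 4 x + theta_exp 2 3 y)"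
      unfolding S_def
    \<comment> \<open>The points \<open>(1 + 2 i)(m - i n)\<close>; the conjugate makes the doubled
      exponent \<open>(5 m^2 - 3 m) + (5 n^2 - n)\<close>, as in the two theta series.\<close>
    proof (rule wsum_reindex[where h = "\<lambda>(m, n). (m + 2 * n, 2 * m - n)"
          and g = "\<lambda>(x, y). ((x + 2 * y) div 5, 2 * ((x + 2 * y) div 5) - y)"])
      show "(case p of (m, n) \<Rightarrow> (m + 2 * n, 2 * m - n)) \<in> {p \<in> UNIV. c p = 0}" for p
        by (cases p) (auto simp: c_def)
      show "(case case p of (x, y) \<Rightarrow> ((x + 2 * y) div 5, 2 * ((x + 2 * y) div 5) - y) of
          (m, n) \<Rightarrow> (m + 2 * n, 2 * m - n)) = p" if "p \<in> {p \<in> UNIV. c p = 0}" for p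
      proof -
        obtain x y where p: "p = (x, y)" by (cases p)
        from that have "(x + 2 * y) mod 5 = 0" by (simp add: c_def p)
        moreover define k where "k = (x + 2 * y) div 5"
        ultimately have "x + 2 * y = 5 * k + 0"
          using mult_div_mod_eq[of 5 "x + 2 * y"] by simp
        then show ?thesis
          unfolding p prod.case prod.inject k_def [symmetric] by presburger
      qed
      show "e (case p of (m, n) \<Rightarrow> (m + 2 * n, 2 * m - n))
          = (case p of (x, y) \<Rightarrow> theta_exp 1 4 x + theta_exp 2 3 y)" for p
      proof (cases p)
        case (Pair m n)
        have "2 * int (e (m + 2 * n, 2 * m - n)) = 2 * int (theta_exp 1 4 m + theta_exp 2 3 n)"
          unfolding e of_nat_add distrib_left[of "2 :: int" "int _"] theta_exp_int
          by (simp add: algebra_simps power2_eq_square)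
        then show ?thesis by (simp add: Pair)
      qed
    qed (auto simp: w)
    ultimately show ?thesis by simp
  qed
  show ?thesis
    unfolding sum S1 S2 S3 S4 S0 by simp
qed

section \<open>Even and odd parts\<close>

definition fps_even :: "'a :: zero fps \<Rightarrow> 'a fps" where
  "fps_even f = Abs_fps (\<lambda>n. fps_nth f (2 * n))"

definition fps_odd :: "'a :: zero fps \<Rightarrow> 'a fps" where
  "fps_odd f = Abs_fps (\<lambda>n. fps_nth f (2 * n + 1))"

lemma fps_even_nth [simp]: "fps_nth (fps_even f) n = fps_nth f (2 * n)"
  by (simp add: fps_even_def)

lemma fps_odd_nth [simp]: "fps_nth (fps_odd f) n = fps_nth f (2 * n + 1)"
  by (simp add: fps_odd_def)

lemma fps_even_add [simp]: "fps_even (f + g) = fps_even f + fps_even (g :: 'a :: comm_ring_1 fps)"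
  and fps_odd_add [simp]: "fps_odd (f + g) = fps_odd f + fps_odd (g :: 'a :: comm_ring_1 fps)"
  and fps_even_diff [simp]: "fps_even (f - g) = fps_even f - fps_even (g :: 'a :: comm_ring_1 fps)"
  and fps_odd_diff [simp]: "fps_odd (f - g) = fps_odd f - fps_odd (g :: 'a :: comm_ring_1 fps)"
  by (rule fps_ext, simp)+

lemma fps_even_const_mult [simp]: "fps_even (fps_const c * f) = fps_const c * fps_even (f :: 'a :: comm_ring_1 fps)"
  and fps_odd_const_mult [simp]: "fps_odd (fps_const c * f) = fps_const c * fps_odd (f :: 'a :: comm_ring_1 fps)"
  by (rule fps_ext, simp)+

lemma fps_even_numeral_mult [simp]: "fps_even (numeral c * f) = numeral c * fps_even (f :: 'a :: comm_ring_1 fps)"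
  and fps_odd_numeral_mult [simp]: "fps_odd (numeral c * f) = numeral c * fps_odd (f :: 'a :: comm_ring_1 fps)"
  by (simp_all only: numeral_fps_const fps_even_const_mult fps_odd_const_mult)

lemma fps_even_X_mult [simp]: "fps_even (fps_X * f) = fps_X * fps_odd (f :: 'a :: comm_ring_1 fps)"
proof (rule fps_ext)
  fix n
  show "fps_nth (fps_even (fps_X * f)) n = fps_nth (fps_X * fps_odd f) n"
    by (cases n) auto
qed

lemma fps_odd_X_mult [simp]: "fps_odd (fps_X * f) = fps_even (f :: 'a :: comm_ring_1 fps)"
  by (rule fps_ext) simp

lemma fps_even_odd_decomp:
  "f = (fps_even f oo fps_X ^ 2) + fps_X * (fps_odd f oo fps_X ^ 2)" for f :: "'a :: comm_ring_1 fps"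
proof (rule fps_ext)
  fix n
  show "fps_nth f n = fps_nth ((fps_even f oo fps_X ^ 2) + fps_X * (fps_odd f oo fps_X ^ 2)) n"
  proof (cases "even n")
    case True
    then show ?thesis by (cases n) (auto simp: fps_nth_compose_X_power)
  next
    case False
    then obtain m where "n = 2 * m + 1" by (elim oddE)
    then show ?thesis by (simp add: fps_nth_compose_X_power)
  qed
qed

lemma fps_even_compose [simp]: "fps_even (f oo fps_X ^ 2) = (f :: 'a :: comm_ring_1 fps)"
  and fps_odd_compose [simp]: "fps_odd (f oo fps_X ^ 2) = (0 :: 'a :: comm_ring_1 fps)"
  by (rule fps_ext, simp add: fps_nth_compose_X_power)+

text \<open>A series in \<open>q^2\<close> can be pulled out of either extraction: multiply the
  decomposition of \<open>f\<close> into even and odd part by it.\<close>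

lemma
  fixes f g :: "'a :: idom fps"
  shows fps_even_compose_mult: "fps_even ((g oo fps_X ^ 2) * f) = g * fps_even f"
    and fps_odd_compose_mult: "fps_odd ((g oo fps_X ^ 2) * f) = g * fps_odd f"
proof -
  have *: "(g oo fps_X ^ 2) * f = (g * fps_even f oo fps_X ^ 2) + fps_X * (g * fps_odd f oo fps_X ^ 2)"
    by (subst fps_even_odd_decomp[of f]) (simp add: fps_compose_mult_distrib algebra_simps)
  show "fps_even ((g oo fps_X ^ 2) * f) = g * fps_even f" "fps_odd ((g oo fps_X ^ 2) * f) = g * fps_odd f"
    unfolding * by simp_all
qed

lemma fps_odd_wsum_even:
  assumes "\<And>i. i \<in> I \<Longrightarrow> even (e i)"
  shows "fps_odd (wsum I w e) = 0"
proof (rule fps_ext)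
  fix n
  have "e i \<noteq> Suc (2 * n)" if "i \<in> I" for i
    using assms[OF that] by auto
  then show "fps_nth (fps_odd (wsum I w e)) n = fps_nth 0 n"
    by (auto simp: wsum_nth intro!: sum.neutral)
qed

text \<open>Here \<open>x + y\<close> is 1, 3 or 5 modulo 6. Negation exchanges the classes 1 and 5,
  the class 3 cancels, and the class 5 is a product of two pentagonal series.\<close>

lemma wsum_odd_class:
  "wsum {p. odd (fst p + snd p)} (\<lambda>(x, y). (- 1) ^ nat \<bar>y\<bar>) (\<lambda>(x, y). theta_exp 1 1 x + theta_exp 5 5 y)
    = 2 * fps_X * (euler_f 4 * euler_f 20)"
proof -
  define w :: "int \<times> int \<Rightarrow> rat" where "w = (\<lambda>(x, y). (- 1) ^ nat \<bar>y\<bar>)"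
  define e where "e = (\<lambda>(x, y). theta_exp 1 1 x + theta_exp 5 5 y)"
  define c :: "int \<times> int \<Rightarrow> int" where "c = (\<lambda>(x, y). (x + y) mod 6)"
  define I :: "(int \<times> int) set" where "I = {p. odd (fst p + snd p)}"
  define S where "S r = wsum {p \<in> I. c p = r} w e" for r
  have w: "w (x, y) = (if even y then 1 else - 1)" for x y
    by (auto simp: w_def minus_one_power_nat_abs)
  have e: "2 * int (e (x, y)) = 2 * x\<^sup>2 + 10 * y\<^sup>2" for x y
    unfolding e_def prod.case of_nat_add distrib_left theta_exp_int by simp
  have cI: "{p \<in> I. c p = r} = {p. c p = r}" if "odd r" for r
  proof -
    have "odd (x + y)" if "(x + y) mod 6 = r" for x y :: int
      using that \<open>odd r\<close> by presburger
    then show ?thesis by (auto simp: I_def c_def)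
  qed
  have "wsum I w e = (\<Sum>r\<in>{1, 3, 5}. S r)"
    unfolding S_def
  proof (rule wsum_partition)
    show "finite {p. p \<in> I \<and> e p = k}" for k
      by (rule finite_subset[OF _ finite_theta_exp_pair[of 1 1 5 5 k]]) (auto simp: e_def)
    fix p assume "p \<in> I"
    moreover obtain x y where p: "p = (x, y)" by (cases p)
    ultimately have "odd (x + y)" by (simp add: I_def)
    then have "(x + y) mod 6 = 1 \<or> (x + y) mod 6 = 3 \<or> (x + y) mod 6 = 5" by presburger
    then show "c p \<in> {1, 3, 5}" by (auto simp: c_def p)
  qed auto
  then have sum: "wsum I w e = S 1 + S 3 + S 5" by (simp add: add_ac)
  have S1: "S 1 = S 5"
    unfolding S_def cI[OF odd_one] cI[OF odd_numeral]
  proof (rule wsum_reindex[where h = "\<lambda>(x, y). (- x, - y)" and g = "\<lambda>(x, y). (- x, - y)"])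
    show "(case p of (x, y) \<Rightarrow> (- x, - y)) \<in> {p. c p = 1}" if "p \<in> {p. c p = 5}" for p
    proof -
      obtain x y where p: "p = (x, y)" by (cases p)
      from that have "(x + y) mod 6 = 5" by (simp add: c_def p)
      then have "(- x + - y) mod 6 = 1" by presburger
      then show ?thesis by (simp only: c_def p prod.case mem_Collect_eq)
    qed
    show "(case p of (x, y) \<Rightarrow> (- x, - y)) \<in> {p. c p = 5}" if "p \<in> {p. c p = 1}" for p
    proof -
      obtain x y where p: "p = (x, y)" by (cases p)
      from that have "(x + y) mod 6 = 1" by (simp add: c_def p)
      then have "(- x + - y) mod 6 = 5" by presburger
      then show ?thesis by (simp only: c_def p prod.case mem_Collect_eq)
    qed
    show "e (case p of (x, y) \<Rightarrow> (- x, - y)) = e p" for p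
      by (cases p; rule nat_eqI_double) (simp add: e)
  qed (auto simp: w)
  have c3: "\<exists>k. x + y = 3 * k \<and> odd k" if "c (x, y) = 3" for x y
  proof -
    have m: "(x + y) mod 6 = 3"
      using that by (simp add: c_def)
    have "x + y = 6 * ((x + y) div 6) + 3"
      using mult_div_mod_eq[of 6 "x + y"] unfolding m by (rule sym)
    then have "x + y = 3 * (2 * ((x + y) div 6) + 1)" by simp
    then show ?thesis by (intro exI[of _ "2 * ((x + y) div 6) + 1"]) simp
  qed
  \<comment> \<open>For \<open>x + y = 3 k\<close> the form is \<open>6 (y - k/2)^2 + 15 k^2 / 2\<close>, invariant under \<open>y \<mapsto> k - y\<close>,
    which changes the sign since \<open>k\<close> is odd.\<close>
  have "S 3 = - S 3"
  proof -
    define h :: "int \<times> int \<Rightarrow> int \<times> int"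
      where "h = (\<lambda>(x, y). (2 * ((x + y) div 3) + y, (x + y) div 3 - y))"
    have key: "c (h p) = 3 \<and> h (h p) = p \<and> w (h p) = - w p \<and> e (h p) = e p" if "c p = 3" for p
    proof -
      obtain x y where p: "p = (x, y)" by (cases p)
      with that obtain k where k: "x = 3 * k - y" "odd k" using c3[of x y] by force
      have h: "h p = (2 * k + y, k - y)" by (simp add: h_def p k)
      have "2 * k + y + (k - y) = 3 * k" by simp
      moreover have "(3 * k) mod 6 = 3" using k(2) by presburger
      ultimately have "c (h p) = 3" by (simp add: h c_def)
      moreover have "h (h p) = p" unfolding h by (simp add: h_def p k)
      moreover have "w (h p) = - w p" unfolding h unfolding p w using k(2) by auto
      moreover have "2 * int (e (2 * k + y, k - y)) = 2 * int (e p)"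
        unfolding p e k(1) by (simp add: power2_eq_square algebra_simps)
      then have "e (h p) = e p" unfolding h by (rule nat_eqI_double)
      ultimately show ?thesis by simp
    qed
    have "wsum {p. c p = 3} w e = wsum {p. c p = 3} (\<lambda>p. - w p) e"
      by (rule wsum_reindex[where h = h and g = h]) (simp_all add: key)
    then show ?thesis
      unfolding S_def cI[OF odd_numeral] wsum_uminus .
  qed
  then have S3: "S 3 = 0"
    by (simp add: fps_eq_iff)
  \<comment> \<open>\<open>x + y sqrt(-5)\<close> is the quotient of \<open>(6 m - 1) + (6 n - 1) sqrt(-5)\<close> by \<open>1 + sqrt(-5)\<close>.\<close>
  have S5: "S 5 = fps_X * (euler_f 4 * euler_f 20)"
  proof -
    have "euler_f 4 * euler_f 20 = theta (- 1) 4 8 * theta (- 1) 20 40"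
      using theta_pentagonal[of 4] theta_pentagonal[of 20] by simp
    also have "\<dots> = wsum UNIV (\<lambda>(x, y). (- 1) ^ nat \<bar>x\<bar> * (- 1) ^ nat \<bar>y\<bar>)
        (\<lambda>(x, y). theta_exp 4 8 x + theta_exp 20 40 y)"
      by (rule theta_mult) auto
    finally have "fps_X * (euler_f 4 * euler_f 20) = wsum UNIV (\<lambda>(x, y). (- 1) ^ nat \<bar>x\<bar> * (- 1) ^ nat \<bar>y\<bar>)
        (\<lambda>p. 1 + (case p of (x, y) \<Rightarrow> theta_exp 4 8 x + theta_exp 20 40 y))"
      by (simp add: wsum_X_mult)
    moreover have "S 5 = wsum UNIV (\<lambda>(x, y). (- 1) ^ nat \<bar>x\<bar> * (- 1) ^ nat \<bar>y\<bar>)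
        (\<lambda>p. 1 + (case p of (x, y) \<Rightarrow> theta_exp 4 8 x + theta_exp 20 40 y))"
      unfolding S_def cI[OF odd_numeral]
    proof (rule wsum_reindex[where h = "\<lambda>(m, n). (5 * n + m - 1, n - m)"
          and g = "\<lambda>(x, y). ((x + y) div 6 + 1 - y, (x + y) div 6 + 1)"])
      fix p :: "int \<times> int"
      obtain m n where p: "p = (m, n)" by (cases p)
      have s: "5 * n + m - 1 + (n - m) = 5 + 6 * (n - 1)" by simp
      have sm: "(5 * n + m - 1 + (n - m)) mod 6 = 5"
        unfolding s mod_mult_self2 by simp
      have sd: "(5 * n + m - 1 + (n - m)) div 6 = n - 1"
        unfolding s by (subst div_mult_self2) auto
      show "(case p of (m, n) \<Rightarrow> (5 * n + m - 1, n - m)) \<in> {p. c p = 5}"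
        using sm by (simp only: p prod.case c_def mem_Collect_eq)
      show "(case case p of (m, n) \<Rightarrow> (5 * n + m - 1, n - m) of
          (x, y) \<Rightarrow> ((x + y) div 6 + 1 - y, (x + y) div 6 + 1)) = p"
        unfolding p prod.case sd by simp
      show "w (case p of (m, n) \<Rightarrow> (5 * n + m - 1, n - m)) = (case p of (x, y) \<Rightarrow> (- 1) ^ nat \<bar>x\<bar> * (- 1) ^ nat \<bar>y\<bar>)"
        by (simp add: p w minus_one_power_nat_abs)
      have "2 * int (e (5 * n + m - 1, n - m)) = 2 * int (1 + (theta_exp 4 8 m + theta_exp 20 40 n))"
        unfolding e of_nat_add distrib_left[of "2 :: int" "int _"] theta_exp_int
        by (simp add: algebra_simps power2_eq_square)
      then show "e (case p of (m, n) \<Rightarrow> (5 * n + m - 1, n - m))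
          = 1 + (case p of (x, y) \<Rightarrow> theta_exp 4 8 x + theta_exp 20 40 y)"
        by (simp add: p)
    next
      fix p assume "p \<in> {p. c p = 5}"
      moreover obtain x y where p: "p = (x, y)" by (cases p)
      moreover define k where "k = (x + y) div 6"
      ultimately have "x + y = 6 * k + 5"
        using mult_div_mod_eq[of 6 "x + y"] by (simp add: c_def)
      then show "(case case p of (x, y) \<Rightarrow> ((x + y) div 6 + 1 - y, (x + y) div 6 + 1) of
          (m, n) \<Rightarrow> (5 * n + m - 1, n - m)) = p"
        unfolding p prod.case prod.inject k_def [symmetric] by presburger
    qed auto
    ultimately show ?thesis by simp
  qed
  show ?thesis
    using sum unfolding S1 S3 S5 by (simp add: w_def e_def I_def)
qed

text \<open>\<open>x^2 + 5 y^2\<close> has the parity of \<open>x + y\<close>, so only the points of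
  \<open>wsum_odd_class\<close> matter. On these \<open>(-1)^x = -(-1)^y\<close>, which accounts for
  the opposite signs.\<close>

lemma
  shows fps_odd_theta_1_5: "fps_odd (theta 1 1 1 * theta (- 1) 5 5) = 2 * (euler_f 2 * euler_f 10)"
    and fps_odd_theta_5_1: "fps_odd (theta (- 1) 1 1 * theta 1 5 5) = - 2 * (euler_f 2 * euler_f 10)"
proof -
  define e where "e = (\<lambda>(x, y). theta_exp 1 1 x + theta_exp 5 5 y)"
  define I where "I r = {p \<in> UNIV. even (fst p + snd p :: int) = r}" for r
  have ev: "even (e p) \<longleftrightarrow> even (fst p + snd p)" for p
  proof (cases p)
    case (Pair x y)
    have "2 * int (e p) = 2 * (x\<^sup>2 + 5 * y\<^sup>2)"
      unfolding e_def Pair prod.case of_nat_add distrib_left theta_exp_int by simp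
    then have "int (e p) = x\<^sup>2 + 5 * y\<^sup>2" by simp
    moreover have "even (x\<^sup>2 + 5 * y\<^sup>2) \<longleftrightarrow> even (x + y)" by simp
    ultimately show ?thesis by (metis Pair even_of_nat fst_conv snd_conv)
  qed
  have f: "fps_odd (wsum UNIV w e) = fps_odd (wsum (I False) w e)" for w
  proof -
    have "wsum UNIV w e = (\<Sum>r\<in>{True, False}. wsum (I r) w e)"
      unfolding I_def
    proof (rule wsum_partition)
      show "finite {p. p \<in> UNIV \<and> e p = k}" for k
        unfolding e_def by (rule finite_theta_exp_pair) auto
    qed auto
    then have "wsum UNIV w e = wsum (I True) w e + wsum (I False) w e" by simp
    moreover have "fps_odd (wsum (I True) w e) = 0"
      by (rule fps_odd_wsum_even) (simp add: I_def ev)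
    ultimately show ?thesis by simp
  qed
  have W: "wsum (I False) (\<lambda>(x, y). (- 1) ^ nat \<bar>y\<bar>) e = 2 * fps_X * (euler_f 4 * euler_f 20)"
    using wsum_odd_class unfolding I_def e_def by simp
  have "euler_f 4 * euler_f 20 = ((euler_f 2 * euler_f 10) oo fps_X ^ 2)"
    using euler_f_compose[of 2] euler_f_compose[of 10] by (simp add: fps_compose_mult_distrib)
  then have W': "fps_odd (wsum (I False) (\<lambda>(x, y). (- 1) ^ nat \<bar>y\<bar>) e) = 2 * (euler_f 2 * euler_f 10)"
    unfolding W mult.assoc by simp
  have "theta 1 1 1 * theta (- 1) 5 5 = wsum UNIV (\<lambda>(x, y). 1 ^ nat \<bar>x\<bar> * (- 1) ^ nat \<bar>y\<bar>) e"
    unfolding e_def by (rule theta_mult) auto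
  then show "fps_odd (theta 1 1 1 * theta (- 1) 5 5) = 2 * (euler_f 2 * euler_f 10)"
    using f W' by simp
  have "theta (- 1) 1 1 * theta 1 5 5 = wsum UNIV (\<lambda>(x, y). (- 1) ^ nat \<bar>x\<bar> * 1 ^ nat \<bar>y\<bar>) e"
    unfolding e_def by (rule theta_mult) auto
  then have "fps_odd (theta (- 1) 1 1 * theta 1 5 5) = fps_odd (wsum (I False) (\<lambda>(x, y). (- 1) ^ nat \<bar>x\<bar> * 1 ^ nat \<bar>y\<bar>) e)"
    using f by simp
  also have "wsum (I False) (\<lambda>(x, y). (- 1) ^ nat \<bar>x\<bar> * 1 ^ nat \<bar>y\<bar>) e
      = wsum (I False) (\<lambda>p. - (case p of (x, y) \<Rightarrow> (- 1) ^ nat \<bar>y\<bar>)) e"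
    by (rule wsum_cong_weight) (auto simp: I_def minus_one_power_nat_abs)
  also have "\<dots> = - wsum (I False) (\<lambda>(x, y). (- 1) ^ nat \<bar>y\<bar>) e"
    by (rule wsum_uminus)
  also have "fps_odd \<dots> = - fps_odd (wsum (I False) (\<lambda>(x, y). (- 1) ^ nat \<bar>y\<bar>) e)"
    by (rule fps_ext) simp
  finally show "fps_odd (theta (- 1) 1 1 * theta 1 5 5) = - 2 * (euler_f 2 * euler_f 10)"
    unfolding W' by simp
qed

section \<open>Eta quotients of level 10\<close>

text \<open>\<open>theta_square_level_5\<close> with products in place of theta series; the
  multiplier \<open>f_2^2 f_5 f_10^2\<close> clears the denominators.\<close>

lemma euler_level_10_relation_1:
  "euler_f 2 ^ 2 * euler_f 5 ^ 5 =
    euler_f 1 ^ 4 * euler_f 5 * euler_f 10 ^ 2 + 4 * fps_X * euler_f 1 * euler_f 2 * euler_f 10 ^ 5"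
proof -
  define a b c d where "a = euler_f 1" and "b = euler_f 2" and "c = euler_f 5" and "d = euler_f 10"
  define t1 t5 t where "t1 = theta (- 1) 1 1" and "t5 = theta (- 1) 5 5"
    and "t = theta (- 1) 1 9 * theta (- 1) 3 7"
  have t1: "t1 * b = a ^ 2" and t5: "t5 * d = c ^ 2" and t: "t * (b * c) = a * d ^ 3"
    using theta_minus_diag[of 1] theta_minus_diag[of 5] theta_level_10_odd
    by (simp_all add: a_def b_def c_def d_def t1_def t5_def t_def)
  have sq: "t1 ^ 2 = t5 ^ 2 - 4 * fps_X * t"
    unfolding t1_def t5_def t_def by (rule theta_square_level_5)
  have "(t1 * b) ^ 2 * (c * d ^ 2) = t1 ^ 2 * (b ^ 2 * c * d ^ 2)"
    by (simp add: power_mult_distrib mult_ac)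
  also have "\<dots> = (t5 * d) ^ 2 * (b ^ 2 * c) - 4 * fps_X * (t * (b * c)) * (b * d ^ 2)"
    unfolding sq by (simp add: power_mult_distrib power2_eq_square algebra_simps)
  finally have "a ^ 4 * c * d ^ 2 = b ^ 2 * c ^ 5 - 4 * fps_X * a * b * d ^ 5"
    unfolding t1 t5 t by (simp add: power_numeral_reduce algebra_simps)
  then show ?thesis
    unfolding a_def b_def c_def d_def by (simp add: algebra_simps)
qed

text \<open>\<open>theta_triangular_square_level_5\<close> with products in place of theta series,
  after multiplication by \<open>f_1^2 f_5^2 f_10\<close> and cancellation of 4.\<close>

lemma euler_level_10_relation_2:
  "euler_f 2 ^ 4 * euler_f 5 ^ 2 * euler_f 10 =
    euler_f 1 * euler_f 2 * euler_f 5 ^ 5 + fps_X * euler_f 1 ^ 2 * euler_f 10 ^ 5"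
proof -
  define a b c d where "a = euler_f 1" and "b = euler_f 2" and "c = euler_f 5" and "d = euler_f 10"
  define u1 u5 v where "u1 = theta 1 0 1" and "u5 = theta 1 0 5"
    and "v = theta 1 1 4 * theta 1 2 3"
  have u1: "u1 * a = 2 * b ^ 2" and u5: "u5 * c = 2 * d ^ 2" and v: "v * (a * d) = b * c ^ 3"
    using theta_triangular[of 1] theta_triangular[of 5] theta_level_5
    by (simp_all add: a_def b_def c_def d_def u1_def u5_def v_def)
  have sq: "u1 ^ 2 = fps_X * u5 ^ 2 + 4 * v"
    unfolding u1_def u5_def v_def by (rule theta_triangular_square_level_5)
  have "(u1 * a) ^ 2 * (c ^ 2 * d) = u1 ^ 2 * (a ^ 2 * c ^ 2 * d)"
    by (simp add: power_mult_distrib mult_ac)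
  also have "\<dots> = fps_X * (u5 * c) ^ 2 * (a ^ 2 * d) + 4 * (v * (a * d)) * (a * c ^ 2)"
    unfolding sq by (simp add: power_mult_distrib power2_eq_square algebra_simps)
  finally have e: "4 * (b ^ 4 * c ^ 2 * d) = 4 * (a * b * c ^ 5 + fps_X * a ^ 2 * d ^ 5)"
    unfolding u1 u5 v by (simp add: power_mult_distrib power_numeral_reduce algebra_simps)
  have "(4 :: rat fps) \<noteq> 0"
    by (simp add: numeral_fps_const)
  from iffD1[OF mult_left_cancel[OF this] e] show ?thesis
    unfolding a_def b_def c_def d_def .
qed

text \<open>The second relation times \<open>f_2\<close>, with \<open>f_2^2 f_5^5\<close> eliminated
  by the first. The coefficients 4 and 1 of the terms with \<open>q\<close> add up to 5, and
  \<open>f_10\<close> cancels.\<close>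

lemma euler_level_10_relation_3:
  "euler_f 2 ^ 5 * euler_f 5 ^ 2 =
    euler_f 1 ^ 5 * euler_f 5 * euler_f 10 + 5 * fps_X * euler_f 1 ^ 2 * euler_f 2 * euler_f 10 ^ 4"
proof -
  define a b c d where "a = euler_f 1" and "b = euler_f 2" and "c = euler_f 5" and "d = euler_f 10"
  have 1: "b ^ 2 * c ^ 5 = a ^ 4 * c * d ^ 2 + 4 * fps_X * a * b * d ^ 5"
    and 2: "b ^ 4 * c ^ 2 * d = a * b * c ^ 5 + fps_X * a ^ 2 * d ^ 5"
    unfolding a_def b_def c_def d_def by (rule euler_level_10_relation_1 euler_level_10_relation_2)+
  have "d * (b ^ 5 * c ^ 2) = b * (b ^ 4 * c ^ 2 * d)"
    by (simp add: power_numeral_reduce algebra_simps)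
  also have "\<dots> = a * (b ^ 2 * c ^ 5) + fps_X * a ^ 2 * b * d ^ 5"
    unfolding 2 by (simp add: power2_eq_square algebra_simps)
  also have "\<dots> = d * (a ^ 5 * c * d + 5 * fps_X * a ^ 2 * b * d ^ 4)"
    unfolding 1 by (simp add: power_numeral_reduce algebra_simps)
  finally show ?thesis
    unfolding a_def b_def c_def d_def by simp
qed

lemma euler_f_compose_numeral:
  "euler_f 2 = euler_f 1 oo fps_X ^ 2" "euler_f 4 = euler_f 2 oo fps_X ^ 2"
  "euler_f 10 = euler_f 5 oo fps_X ^ 2" "euler_f 20 = euler_f 10 oo fps_X ^ 2"
  using euler_f_compose[of 1] euler_f_compose[of 2] euler_f_compose[of 5] euler_f_compose[of 10]
  by simp_all

text \<open>Divided by \<open>f_2 f_5^2\<close>, the second relation reads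
  \<open>f_1 f_5^3 = f_2^3 f_10 - q f_20^2 phi(-q) phi(q^5)\<close>. Apart from \<open>q\<close> and
  the theta product only series in \<open>q^2\<close> occur, so the odd part of that product
  suffices.\<close>

lemma fps_even_euler_1_5: "fps_even (euler_f 1 * euler_f 5 ^ 3)
    = euler_f 1 ^ 3 * euler_f 5 + 2 * fps_X * (euler_f 2 * euler_f 10 ^ 3)"
proof -
  define a b c d g where "a = euler_f 1" and "b = euler_f 2" and "c = euler_f 5" and "d = euler_f 10"
    and "g = euler_f 20"
  have nz: "b \<noteq> 0" "c \<noteq> 0" by (simp_all add: b_def c_def)
  define t s where "t = theta (- 1) 1 1" and "s = theta 1 5 5"
  have t: "t * b = a ^ 2" and s: "s * (c ^ 2 * g ^ 2) = d ^ 5"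
    using theta_minus_diag[of 1] theta_plus_diag[of 5]
    by (simp_all add: a_def b_def c_def d_def g_def s_def t_def)
  have 2: "b ^ 4 * c ^ 2 * d = a * b * c ^ 5 + fps_X * a ^ 2 * d ^ 5"
    unfolding a_def b_def c_def d_def by (rule euler_level_10_relation_2)
  have "b * c ^ 2 * (a * c ^ 3) = b ^ 4 * c ^ 2 * d - fps_X * a ^ 2 * d ^ 5"
    unfolding 2 by (simp add: power_numeral_reduce algebra_simps)
  also have "\<dots> = b * c ^ 2 * (b ^ 3 * d - fps_X * (g ^ 2 * (t * s)))"
    unfolding t [symmetric] s [symmetric] by (simp add: power_numeral_reduce algebra_simps)
  finally have "a * c ^ 3 = b ^ 3 * d - fps_X * (g ^ 2 * (t * s))"
    using nz by simp
  also have "b ^ 3 * d = (a ^ 3 * c oo fps_X ^ 2)"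
    unfolding a_def b_def c_def d_def euler_f_compose_numeral
    by (simp add: fps_compose_mult_distrib fps_compose_power)
  also have "g ^ 2 = (d ^ 2 oo fps_X ^ 2)"
    unfolding d_def g_def euler_f_compose_numeral(4) by (simp add: fps_compose_power)
  finally have "fps_even (a * c ^ 3) = a ^ 3 * c - fps_X * (d ^ 2 * fps_odd (t * s))"
    by (simp add: fps_odd_compose_mult)
  also have "fps_odd (t * s) = - 2 * (b * d)"
    unfolding t_def s_def b_def d_def by (rule fps_odd_theta_5_1)
  finally show ?thesis
    unfolding a_def b_def c_def d_def by (simp add: power_numeral_reduce algebra_simps)
qed

text \<open>Divided by \<open>f_1^2 f_10\<close>, the third relation reads
  \<open>f_1^3 f_5 = f_4^2 phi(q) phi(-q^5) - 5 q f_2 f_10^3\<close>, and again only the odd part of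
  the theta product is required.\<close>

lemma fps_odd_euler_1_5: "fps_odd (euler_f 1 ^ 3 * euler_f 5)
    = 2 * (euler_f 2 ^ 3 * euler_f 10) - 5 * (euler_f 1 * euler_f 5 ^ 3)"
proof -
  define a b c d g where "a = euler_f 1" and "b = euler_f 2" and "c = euler_f 5" and "d = euler_f 10"
    and "g = euler_f 4"
  have nz: "a \<noteq> 0" "d \<noteq> 0" by (simp_all add: a_def d_def)
  define s t where "s = theta 1 1 1" and "t = theta (- 1) 5 5"
  have t: "t * d = c ^ 2" and s: "s * (a ^ 2 * g ^ 2) = b ^ 5"
    using theta_minus_diag[of 5] theta_plus_diag[of 1]
    by (simp_all add: a_def b_def c_def d_def g_def s_def t_def)
  have 3: "b ^ 5 * c ^ 2 = a ^ 5 * c * d + 5 * fps_X * a ^ 2 * b * d ^ 4"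
    unfolding a_def b_def c_def d_def by (rule euler_level_10_relation_3)
  have "a ^ 2 * d * (a ^ 3 * c) = b ^ 5 * c ^ 2 - 5 * fps_X * a ^ 2 * b * d ^ 4"
    unfolding 3 by (simp add: power_numeral_reduce algebra_simps)
  also have "\<dots> = a ^ 2 * d * (g ^ 2 * (s * t) - 5 * (fps_X * (b * d ^ 3)))"
    unfolding t [symmetric] s [symmetric] by (simp add: power_numeral_reduce algebra_simps)
  finally have "a ^ 3 * c = g ^ 2 * (s * t) - 5 * (fps_X * (b * d ^ 3))"
    using nz by simp
  also have "b * d ^ 3 = (a * c ^ 3 oo fps_X ^ 2)"
    unfolding a_def b_def c_def d_def euler_f_compose_numeral
    by (simp add: fps_compose_mult_distrib fps_compose_power)
  also have "g ^ 2 = (b ^ 2 oo fps_X ^ 2)"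
    unfolding b_def g_def euler_f_compose_numeral(2) by (simp add: fps_compose_power)
  finally have "fps_odd (a ^ 3 * c) = b ^ 2 * fps_odd (s * t) - 5 * (a * c ^ 3)"
    by (simp add: fps_odd_compose_mult)
  also have "fps_odd (s * t) = 2 * (b * d)"
    unfolding t_def s_def b_def d_def by (rule fps_odd_theta_1_5)
  finally show ?thesis
    unfolding a_def b_def c_def d_def by (simp add: power_numeral_reduce algebra_simps)
qed

section \<open>Generating functions and the extraction of coefficients\<close>

definition P_ser :: "rat fps" where "P_ser = euler_f 1 ^ 4 * euler_f 5 ^ 4"
definition P2_ser :: "rat fps" where "P2_ser = euler_f 2 ^ 4 * euler_f 10 ^ 4"
definition G_ser :: "rat fps" where "G_ser = euler_f 1 * euler_f 2 * euler_f 5 ^ 3 * euler_f 10 ^ 3"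
definition M_ser :: "rat fps" where "M_ser = euler_f 2 ^ 5 * euler_f 5 ^ 5 / (euler_f 1 * euler_f 10)"
definition T_ser :: "rat fps" where "T_ser = euler_f 1 ^ 5 * euler_f 10 ^ 5 / (euler_f 2 * euler_f 5)"

text \<open>The third relation times \<open>f_5^3\<close> gives the first form of
  \<open>M_ser\<close>, the first relation times \<open>f_2^3\<close> the second form, whose factors
  \<open>f_2^3 f_10\<close> and \<open>f_2 f_10^3\<close> are series in \<open>q^2\<close>.\<close>

lemma M_ser_eq: "M_ser = P_ser + 5 * (fps_X * G_ser)"
  and M_ser_eq': "M_ser = euler_f 2 ^ 3 * euler_f 10 *
    (euler_f 1 ^ 3 * euler_f 5 + 4 * (fps_X * (euler_f 2 * euler_f 10 ^ 3)))"
  and T_ser_eq: "T_ser = 5 * G_ser - 4 * P2_ser"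
proof -
  define a b c d where "a = euler_f 1" and "b = euler_f 2" and "c = euler_f 5" and "d = euler_f 10"
  have nz: "a \<noteq> 0" "b \<noteq> 0" "c \<noteq> 0" "d \<noteq> 0" by (simp_all add: a_def b_def c_def d_def)
  have 1: "b ^ 2 * c ^ 5 = a ^ 4 * c * d ^ 2 + 4 * fps_X * a * b * d ^ 5"
    and 3: "b ^ 5 * c ^ 2 = a ^ 5 * c * d + 5 * fps_X * a ^ 2 * b * d ^ 4"
    unfolding a_def b_def c_def d_def by (rule euler_level_10_relation_1 euler_level_10_relation_3)+
  have "b ^ 5 * c ^ 5 = c ^ 3 * (b ^ 5 * c ^ 2)"
    by (simp add: power_numeral_reduce algebra_simps)
  also have "\<dots> = (P_ser + 5 * (fps_X * G_ser)) * (a * d)"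
    unfolding 3 by (simp add: P_ser_def G_ser_def a_def b_def c_def d_def power_numeral_reduce algebra_simps)
  finally show "M_ser = P_ser + 5 * (fps_X * G_ser)"
    unfolding M_ser_def a_def [symmetric] b_def [symmetric] c_def [symmetric] d_def [symmetric]
    using nz by simp
  have "b ^ 5 * c ^ 5 = b ^ 3 * (b ^ 2 * c ^ 5)"
    by (simp add: power_numeral_reduce algebra_simps)
  also have "\<dots> = (b ^ 3 * d * (a ^ 3 * c + 4 * (fps_X * (b * d ^ 3)))) * (a * d)"
    unfolding 1 by (simp add: power_numeral_reduce algebra_simps)
  finally show "M_ser = euler_f 2 ^ 3 * euler_f 10 *
    (euler_f 1 ^ 3 * euler_f 5 + 4 * (fps_X * (euler_f 2 * euler_f 10 ^ 3)))"
    unfolding M_ser_def a_def [symmetric] b_def [symmetric] c_def [symmetric] d_def [symmetric]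
    using nz by simp
  \<comment> \<open>The multipliers make the terms \<open>20 q a^2 b d^5\<close> of the two
    relations cancel.\<close>
  have "5 * a * (b ^ 2 * c ^ 5) - 4 * d * (b ^ 5 * c ^ 2) = c * (a ^ 5 * d ^ 2)"
    unfolding 1 3 by (simp add: power_numeral_reduce algebra_simps)
  then have "c * (5 * a * b ^ 2 * c ^ 4 - 4 * b ^ 5 * c * d) = c * (a ^ 5 * d ^ 2)"
    by (simp add: power_numeral_reduce algebra_simps)
  then have 4: "a ^ 5 * d ^ 2 = 5 * a * b ^ 2 * c ^ 4 - 4 * b ^ 5 * c * d"
    using nz by simp
  have "a ^ 5 * d ^ 5 = d ^ 3 * (a ^ 5 * d ^ 2)"
    by (simp add: power_numeral_reduce algebra_simps)
  also have "\<dots> = (5 * G_ser - 4 * P2_ser) * (b * c)"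
    unfolding 4 by (simp add: P2_ser_def G_ser_def a_def b_def c_def d_def power_numeral_reduce algebra_simps)
  finally show "T_ser = 5 * G_ser - 4 * P2_ser"
    unfolding T_ser_def a_def [symmetric] b_def [symmetric] c_def [symmetric] d_def [symmetric]
    using nz by simp
qed

lemma P2_ser_eq_compose: "P2_ser = P_ser oo fps_X ^ 2"
  unfolding P_ser_def P2_ser_def euler_f_compose_numeral
  by (simp add: fps_compose_mult_distrib fps_compose_power)

text \<open>\<open>G_ser\<close> is \<open>f_1 f_5^3\<close> times the same series at
  \<open>q^2\<close>, so \<open>fps_even_euler_1_5\<close> determines its even part.\<close>

lemma fps_even_G_ser: "fps_even G_ser = P_ser + 2 * (fps_X * G_ser)"
proof -
  have "G_ser = (euler_f 2 * euler_f 10 ^ 3) * (euler_f 1 * euler_f 5 ^ 3)"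
    by (simp add: G_ser_def)
  also have "euler_f 2 * euler_f 10 ^ 3 = (euler_f 1 * euler_f 5 ^ 3 oo fps_X ^ 2)"
    unfolding euler_f_compose_numeral by (simp add: fps_compose_mult_distrib fps_compose_power)
  finally have G: "G_ser = (euler_f 1 * euler_f 5 ^ 3 oo fps_X ^ 2) * (euler_f 1 * euler_f 5 ^ 3)" .
  have "fps_even G_ser = euler_f 1 * euler_f 5 ^ 3 *
      (euler_f 1 ^ 3 * euler_f 5 + 2 * fps_X * (euler_f 2 * euler_f 10 ^ 3))"
    unfolding G fps_even_compose_mult fps_even_euler_1_5 ..
  then show ?thesis
    by (simp add: P_ser_def G_ser_def power_numeral_reduce algebra_simps)
qed

text \<open>The odd part of \<open>M_ser\<close> is computed from both of its forms. One contains
  \<open>fps_odd P_ser\<close> and the known \<open>fps_even G_ser\<close>, the other reduces to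
  \<open>fps_odd_euler_1_5\<close>; the comparison is solved for
  \<open>fps_odd P_ser\<close>.\<close>

lemma fps_odd_P_ser: "fps_odd P_ser = - 4 * P_ser - 8 * (fps_X * P2_ser)"
proof -
  define a b c d where "a = euler_f 1" and "b = euler_f 2" and "c = euler_f 5" and "d = euler_f 10"
  have "M_ser = (b ^ 3 * d) * (a ^ 3 * c + 4 * (fps_X * (b * d ^ 3)))"
    unfolding a_def b_def c_def d_def by (rule M_ser_eq')
  also have "b ^ 3 * d = (a ^ 3 * c oo fps_X ^ 2)"
    unfolding a_def b_def c_def d_def euler_f_compose_numeral
    by (simp add: fps_compose_mult_distrib fps_compose_power)
  also have "b * d ^ 3 = (a * c ^ 3 oo fps_X ^ 2)"
    unfolding a_def b_def c_def d_def euler_f_compose_numeral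
    by (simp add: fps_compose_mult_distrib fps_compose_power)
  finally have M: "M_ser = (a ^ 3 * c oo fps_X ^ 2) * (a ^ 3 * c + 4 * (fps_X * (a * c ^ 3 oo fps_X ^ 2)))" .
  have "fps_odd M_ser = a ^ 3 * c * (fps_odd (a ^ 3 * c) + 4 * (a * c ^ 3))"
    unfolding M fps_odd_compose_mult by simp
  also have "fps_odd (a ^ 3 * c) = 2 * (b ^ 3 * d) - 5 * (a * c ^ 3)"
    unfolding a_def b_def c_def d_def by (rule fps_odd_euler_1_5)
  \<comment> \<open>Adding and subtracting \<open>8 q f_2^4 f_10^4\<close> completes the first
    product to the second form of \<open>M_ser\<close>.\<close>
  also have "a ^ 3 * c * (2 * (b ^ 3 * d) - 5 * (a * c ^ 3) + 4 * (a * c ^ 3))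
      = 2 * (b ^ 3 * d * (a ^ 3 * c + 4 * (fps_X * (b * d ^ 3)))) - 8 * (fps_X * P2_ser) - P_ser"
    by (simp add: P_ser_def P2_ser_def a_def b_def c_def d_def power_numeral_reduce algebra_simps)
  also have "b ^ 3 * d * (a ^ 3 * c + 4 * (fps_X * (b * d ^ 3))) = P_ser + 5 * (fps_X * G_ser)"
    unfolding M_ser_eq [symmetric] M_ser_eq' a_def b_def c_def d_def ..
  finally have "fps_odd P_ser + 5 * fps_even G_ser = 2 * (P_ser + 5 * (fps_X * G_ser)) - 8 * (fps_X * P2_ser) - P_ser"
    unfolding M_ser_eq by simp
  then have "fps_odd P_ser = 2 * (P_ser + 5 * (fps_X * G_ser)) - 8 * (fps_X * P2_ser) - P_ser
      - 5 * (P_ser + 2 * (fps_X * G_ser))"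
    unfolding fps_even_G_ser by (simp only: eq_diff_eq)
  then show ?thesis
    by (simp add: algebra_simps)
qed

text \<open>Raising the exponent of 2 by one is an extraction of odd indices, since
  \<open>2 (m + 1) = (2 m + 1) + 1\<close>. The inhomogeneity is \<open>r = 5\<close> for
  \<open>A\<close> and \<open>B\<close>, and \<open>r = 0\<close> for \<open>C\<close>.\<close>

lemma fps_odd_iterate:
  fixes u :: "nat \<Rightarrow> rat" and a :: "nat \<Rightarrow> int" and r :: int
  assumes base: "Abs_fps (\<lambda>m. u (2 * (m + 1) - s))
      = of_int (a 1) * P_ser - 8 * of_int (a 0) * (fps_X * P2_ser) + of_int (2 * r) * (fps_X * G_ser)"
    and rec: "\<And>k. a (Suc (Suc k)) = - 4 * a (Suc k) - 8 * a k + r * 2 ^ Suc k"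
  shows "Abs_fps (\<lambda>m. u (2 ^ Suc k * (m + 1) - s))
      = of_int (a (Suc k)) * P_ser - 8 * of_int (a k) * (fps_X * P2_ser)
        + of_int (r * 2 ^ Suc k) * (fps_X * G_ser)"
proof (induction k)
  case 0
  then show ?case using base by (simp add: mult.commute)
next
  case (Suc k)
  have oi: "fps_odd (of_int z * f) = of_int z * fps_odd f" for z and f :: "rat fps"
    by (simp flip: fps_of_int)
  have "Abs_fps (\<lambda>m. u (2 ^ Suc (Suc k) * (m + 1) - s)) = fps_odd (Abs_fps (\<lambda>m. u (2 ^ Suc k * (m + 1) - s)))"
    by (rule fps_ext) (simp add: algebra_simps)
  \<comment> \<open>\<open>fps_X * P2_ser\<close> becomes \<open>fps_even P2_ser\<close>, which is
    \<open>P_ser\<close> because \<open>P2_ser\<close> is \<open>P_ser\<close> at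
    \<open>q^2\<close>.\<close>
  also have "\<dots> = of_int (a (Suc k)) * fps_odd P_ser - 8 * (of_int (a k) * P_ser)
      + of_int (r * 2 ^ Suc k) * fps_even G_ser"
    unfolding Suc.IH by (simp add: oi mult.assoc P2_ser_eq_compose del: of_int_mult of_int_power)
  finally show ?case
    unfolding rec fps_odd_P_ser fps_even_G_ser by (simp add: algebra_simps)
qed

text \<open>Multiplication by \<open>q\<close> moves the start from -1 to 0: with
  \<open>m = n + 1\<close> the index \<open>2^k n + 2^(k+1) - s\<close> is
  \<open>2^k (m + 1) - s\<close>.\<close>

lemma series_from_m1_eq:
  fixes u :: "nat \<Rightarrow> rat" and f :: "rat fps"
  assumes "Abs_fps (\<lambda>m. u (2 ^ k * (m + 1) - s)) = f" and "f' = fps_to_fls f / fls_X"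
  shows "series_from_m1 (\<lambda>n. u (nat (2 ^ k * n + 2 ^ (k + 1) - int s))) = f'"
proof -
  have "fls_X * series_from_m1 (\<lambda>n. u (nat (2 ^ k * n + 2 ^ (k + 1) - int s))) = fps_to_fls f"
  proof (rule fls_eqI)
    fix n :: int
    show "fls_nth (fls_X * series_from_m1 (\<lambda>n. u (nat (2 ^ k * n + 2 ^ (k + 1) - int s)))) n = fls_nth (fps_to_fls f) n"
    proof (cases "n \<ge> 0")
      case True
      \<comment> \<open>Truncated subtraction on \<open>nat\<close> agrees with \<open>nat\<close>
        of the integer difference, also where the latter is negative.\<close>
      have "nat (2 ^ k * (n - 1) + 2 ^ (k + 1) - int s) = 2 ^ k * (nat n + 1) - s"
      proof -
        have "2 ^ k * (n - 1) + 2 ^ (k + 1) - int s = int (2 ^ k * (nat n + 1)) - int s"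
          using True by (simp add: algebra_simps)
        then show ?thesis by (simp only: nat_minus_as_int)
      qed
      with True show ?thesis
        unfolding assms(1) [symmetric] by (simp add: fls_X_times_conv_shift fls_nth_series_from_m1)
    next
      case False
      then show ?thesis by (simp add: fls_X_times_conv_shift fls_nth_series_from_m1)
    qed
  qed
  moreover have "(fls_X :: rat fls) \<noteq> 0" by simp
  ultimately show ?thesis
    unfolding assms(2) by (metis nonzero_mult_div_cancel_left)
qed

theorem theorem3p1:
  fixes k :: nat
  assumes "k \<ge> 1"
  shows "(series_from_m1 (\<lambda>n. M (nat (2 ^ k * n + 2 ^ (k + 1) - 1)))
           = of_int (A k) * (F 1 ^ 4 * F 5 ^ 4 / fls_X)
             - 8 * of_int (A (k - 1)) * F 2 ^ 4 * F 10 ^ 4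
             + 5 * 2 ^ k * F 1 * F 2 * F 5 ^ 3 * F 10 ^ 3)
    \<and> (series_from_m1 (\<lambda>n. T_star (nat (2 ^ k * n + 2 ^ (k + 1) - 2)))
           = of_int (B k) * (F 1 ^ 4 * F 5 ^ 4 / fls_X)
             - 8 * of_int (B (k - 1)) * F 2 ^ 4 * F 10 ^ 4
             + 5 * 2 ^ k * F 1 * F 2 * F 5 ^ 3 * F 10 ^ 3)
    \<and> (series_from_m1 (\<lambda>n. P_star (nat (2 ^ k * n + 2 ^ (k + 1) - 1)))
           = of_int (C k) * (F 1 ^ 4 * F 5 ^ 4 / fls_X)
             - 8 * of_int (C (k - 1)) * F 2 ^ 4 * F 10 ^ 4)"
proof -
  obtain j where k: "k = Suc j"
    using assms by (cases k) auto
  have odd: "Abs_fps (\<lambda>m. fps_nth f (2 * (m + 1) - 1)) = fps_odd f" for f :: "rat fps"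
    by (rule fps_ext) simp
  have even: "Abs_fps (\<lambda>m. fps_nth f (2 * (m + 1) - 2)) = fps_even f" for f :: "rat fps"
    by (rule fps_ext) simp
  have M: "Abs_fps (\<lambda>m. M (2 ^ Suc j * (m + 1) - 1)) = of_int (A (Suc j)) * P_ser
      - 8 * of_int (A j) * (fps_X * P2_ser) + of_int (5 * 2 ^ Suc j) * (fps_X * G_ser)"
  proof (rule fps_odd_iterate)
    have "fps_odd M_ser = P_ser - 8 * (fps_X * P2_ser) + 10 * (fps_X * G_ser)"
      unfolding M_ser_eq by (simp add: fps_odd_P_ser fps_even_G_ser)
    then show "Abs_fps (\<lambda>m. M (2 * (m + 1) - 1)) = of_int (A 1) * P_ser
        - 8 * of_int (A 0) * (fps_X * P2_ser) + of_int (2 * 5) * (fps_X * G_ser)"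
      unfolding M_def M_ser_def [symmetric] odd by simp
  qed simp
  \<comment> \<open>With offset 2 the first extraction takes the even indices, as
    \<open>2 (m + 1) - 2 = 2 m\<close>; all later ones take odd indices as for
    \<open>M\<close>.\<close>
  have T: "Abs_fps (\<lambda>m. T_star (2 ^ Suc j * (m + 1) - 2)) = of_int (B (Suc j)) * P_ser
      - 8 * of_int (B j) * (fps_X * P2_ser) + of_int (5 * 2 ^ Suc j) * (fps_X * G_ser)"
  proof (rule fps_odd_iterate)
    have "fps_even T_ser = P_ser + 10 * (fps_X * G_ser)"
    proof -
      have "fps_even T_ser = 5 * fps_even G_ser - 4 * fps_even P2_ser"
        unfolding T_ser_eq by simp
      also have "fps_even P2_ser = P_ser"
        unfolding P2_ser_eq_compose by simp
      finally show ?thesis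
        unfolding fps_even_G_ser by (simp add: algebra_simps)
    qed
    then show "Abs_fps (\<lambda>m. T_star (2 * (m + 1) - 2)) = of_int (B 1) * P_ser
        - 8 * of_int (B 0) * (fps_X * P2_ser) + of_int (2 * 5) * (fps_X * G_ser)"
      unfolding T_star_def T_ser_def [symmetric] even by simp
  qed simp
  have P: "Abs_fps (\<lambda>m. P_star (2 ^ Suc j * (m + 1) - 1)) = of_int (C (Suc j)) * P_ser
      - 8 * of_int (C j) * (fps_X * P2_ser) + of_int (0 * 2 ^ Suc j) * (fps_X * G_ser)"
  proof (rule fps_odd_iterate)
    show "Abs_fps (\<lambda>m. P_star (2 * (m + 1) - 1)) = of_int (C 1) * P_ser
        - 8 * of_int (C 0) * (fps_X * P2_ser) + of_int (2 * 0) * (fps_X * G_ser)"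
      unfolding P_star_def P_ser_def [symmetric] odd by (simp add: fps_odd_P_ser)
  qed simp
  note to_fls = fls_times_fps_to_fls fps_to_fls_power P_ser_def P2_ser_def G_ser_def
  have fld: "(x * p - 8 * y * (t * q) + z * (t * g)) / t = x * (p / t) - 8 * y * q + z * g"
    if "t \<noteq> 0" for t x y z p q g :: "rat fls"
    using that by (simp add: field_simps)
  have nz: "(fls_X :: rat fls) \<noteq> 0" by simp
  \<comment> \<open>Division by \<open>q\<close> leaves a pole only in the term with
    \<open>P_ser\<close>; the other two terms carry a factor \<open>q\<close> that cancels.\<close>
  have conv: "of_int x * (F 1 ^ 4 * F 5 ^ 4 / fls_X) - 8 * of_int y * F 2 ^ 4 * F 10 ^ 4
        + of_int z * F 1 * F 2 * F 5 ^ 3 * F 10 ^ 3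
      = fps_to_fls (of_int x * P_ser - 8 * of_int y * (fps_X * P2_ser) + of_int z * (fps_X * G_ser)) / fls_X"
    for x y z :: int
  proof -
    have e: "fps_to_fls (of_int x * P_ser - 8 * of_int y * (fps_X * P2_ser) + of_int z * (fps_X * G_ser))
        = of_int x * (F 1 ^ 4 * F 5 ^ 4) - 8 * of_int y * (fls_X * (F 2 ^ 4 * F 10 ^ 4))
          + of_int z * (fls_X * (F 1 * F 2 * F 5 ^ 3 * F 10 ^ 3))"
      by (simp add: to_fls)
    show ?thesis
      unfolding e fld[OF nz] by (simp only: mult.assoc)
  qed
  have "of_int (5 * 2 ^ Suc j) = (5 * 2 ^ Suc j :: rat fls)" by simp
  then show ?thesis
    using series_from_m1_eq[OF M conv] series_from_m1_eq[OF T conv] series_from_m1_eq[OF P conv]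
    unfolding k by simp
qed

end
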